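(* There exists $\varepsilon>0$ such that for every $m>0$, $H>0$ with $0<m/H<\varepsilon$ the following holds. Let $A$ be any single-mode subsystem of the scalar field, given by a pair of smooth compactly supported profiles $\Gamma_A^{(i)}=(G_A^{(i)},F_A^{(i)})$, $i=1,2$, with $\int_{\mathbb{R}^3}\big(G_A^{(1)}F_A^{(2)}-F_A^{(1)}G_A^{(2)}\big)\,d^3y=1$, and let $A_R$ be the same mode scaled to physical size $R$. Then there exists $\Lambda>0$ (depending on the profiles and on $m/H$) such that for all $R>0$ with $RH\ge\Lambda$, $$S\big(\nu_{A_R}^{\mathrm{BD}}\big)\;\ge\;S\big(\nu_{A_R}^{\mathrm{Mink}}\big),$$ i.e. the von Neumann entropy of the mode in the Bunch-Davies vacuum is equal to or greater than that of the same mode in the (massless) Minkowski vacuum.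
   Context: Units $\hbar=c=1$. A free real scalar field of mass $m>0$ is considered in the cosmological patch of de Sitter spacetime with Hubble rate $H$, on the constant-time slice $\Sigma\cong\mathbb{R}^3$ on which the scale factor is normalized to $1$ (so coordinates are physical lengths). It is compared with a free massless real scalar field on a constant inertial time slice $\mathbb{R}^3$ of Minkowski spacetime; modes in the two spacetimes are identified when they are defined by the same smearing functions on $\mathbb{R}^3$. Linear observables: for real smooth compactly supported $f,g$ on $\mathbb{R}^3$ and $\gamma=(g,f)$, let $\hat O_\gamma=\int_{\mathbb{R}^3}(f\hat\Phi-g\hat\Pi)\,d^3x$, where $[\hat\Phi(x),\hat\Pi(x')]=i\delta^{(3)}(x-x')$. Thus $[\hat O_\gamma,\hat O_{\gamma'}]=i\int(g f'-f g')\,d^3x$. States: both vacua are zero-mean Gaussian states with symmetrized two-point function $$\langle\{\hat O_\gamma,\hat O_{\gamma'}\}\rangle=2\,\mathrm{Re}\int\frac{d^3k}{(2\pi)^3}\,\big(\tilde f(k)\varphi_k-\tilde g(k)\pi_k\big)\,\overline{\big(\tilde f'(k)\varphi_k-\tilde g'(k)\pi_k\big)},$$ where $\{X,Y\}=XY+YX$, $\tilde f(k)=\int f(x)e^{-ik\cdot x}d^3x$, and, writing $k$ also for $|k|$: - Bunch-Davies vacuum: $\varphi_k=\sqrt{\tfrac{\pi}{4H}}\,H^{(1)}_{n}(k/H)$ and $\pi_k=-\sqrt{\tfrac{\pi H}{4}}\,\big[\mu^2H^{(1)}_{n}(k/H)+\tfrac{k}{H}H^{(1)}_{n-1}(k/H)\big]$,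 where $H^{(1)}_n$ is the Hankel function of the first kind, $\mu^2=\tfrac32-\sqrt{\tfrac94-\tfrac{m^2}{H^2}}$ and $n=\tfrac32-\mu^2$. - Massless Minkowski vacuum: $\varphi_k=1/\sqrt{2k}$, $\pi_k=-i\sqrt{k/2}$. Single-mode subsystem: the algebra generated by two observables $\hat O_{\gamma^{(1)}},\hat O_{\gamma^{(2)}}$ with $[\hat O_{\gamma^{(1)}},\hat O_{\gamma^{(2)}}]=i$. For dimensionless profiles $\Gamma^{(i)}=(G^{(i)},F^{(i)})$ (real, smooth, compactly supported functions on $\mathbb{R}^3$), the mode scaled to size $R>0$ is defined by $\gamma^{(i)}_R=(g_R^{(i)},f_R^{(i)})$ with $f_R^{(i)}(x)=R^{-2}F^{(i)}(x/R)$ and $g_R^{(i)}(x)=R^{-1}G^{(i)}(x/R)$; this preserves the commutation relations. Entropy: for a single mode, $\boldsymbol\sigma$ is the $2\times2$ matrix with entries $\langle\{\hat O_{\gamma^{(i)}},\hat O_{\gamma^{(j)}}\}\rangle$, $\nu=\sqrt{\det\boldsymbol\sigma}\ge1$, and the von Neumann entropy is $$S(\nu)=\tfrac{\nu+1}{2}\log_2\tfrac{\nu+1}{2}-\tfrac{\nu-1}{2}\log_2\tfrac{\nu-1}{2},$$ with $0\log_2 0=0$. Superscripts BD and Mink indicate the state used. *)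

theory Defs
  imports "HOL-Analysis.Analysis"
begin

type_synonym space = "real ^ 3"

section \<open>Test functions\<close>

fun Ck :: "nat \<Rightarrow> (space \<Rightarrow> real) \<Rightarrow> bool" where
  "Ck 0 f \<longleftrightarrow> continuous_on UNIV f"
| "Ck (Suc k) f \<longleftrightarrow> (\<forall>x. f differentiable (at x)) \<and>
     (\<forall>i. Ck k (\<lambda>x. frechet_derivative f (at x) (axis i 1)))"

definition smooth :: "(space \<Rightarrow> real) \<Rightarrow> bool" where
  "smooth f \<longleftrightarrow> (\<forall>k. Ck k f)"

definition compactly_supported :: "(space \<Rightarrow> real) \<Rightarrow> bool" where
  "compactly_supported f \<longleftrightarrow> compact (closure {x. f x \<noteq> 0})"

definition test_function :: "(space \<Rightarrow> real) \<Rightarrow> bool" where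
  "test_function f \<longleftrightarrow> smooth f \<and> compactly_supported f"

section \<open>Smearing pairs and single-mode subsystems\<close>

text \<open>A smearing pair is \<open>(g, f)\<close>, in this order; it labels the linear observable
  \<open>O = \<integral> (f \<Phi> - g \<Pi>)\<close>.\<close>

type_synonym smearing = "(space \<Rightarrow> real) \<times> (space \<Rightarrow> real)"

text \<open>The commutator of the observables labelled by \<open>\<gamma>\<close> and \<open>\<gamma>'\<close> is
  \<open>\<i>\<close> times the following number.\<close>

definition symplectic :: "smearing \<Rightarrow> smearing \<Rightarrow> real" where
  "symplectic \<gamma> \<gamma>' =
     (LINT x|lborel. fst \<gamma> x * snd \<gamma>' x - snd \<gamma> x * fst \<gamma>' x)"

text \<open>The two generating observables are indexed by the two-element type \<open>2\<close>.\<close>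

definition single_mode :: "(2 \<Rightarrow> smearing) \<Rightarrow> bool" where
  "single_mode \<Gamma> \<longleftrightarrow>
     (\<forall>i. test_function (fst (\<Gamma> i)) \<and> test_function (snd (\<Gamma> i))) \<and>
     symplectic (\<Gamma> 1) (\<Gamma> 2) = 1"

definition scale_smearing :: "real \<Rightarrow> smearing \<Rightarrow> smearing" where
  "scale_smearing R \<Gamma> =
     ((\<lambda>x. fst \<Gamma> (x /\<^sub>R R) / R), (\<lambda>x. snd \<Gamma> (x /\<^sub>R R) / R\<^sup>2))"

definition scale_mode :: "real \<Rightarrow> (2 \<Rightarrow> smearing) \<Rightarrow> (2 \<Rightarrow> smearing)" where
  "scale_mode R \<Gamma> = (\<lambda>i. scale_smearing R (\<Gamma> i))"

section \<open>Bessel and Hankel functions\<close>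

text \<open>Real order and argument \<open>x > 0\<close>; there, \<open>J\<close> and \<open>Y\<close> are real. At
  integer orders \<open>Y\<close> is the limit in the order, as usual. The reciprocal Gamma function
  vanishes at the poles of Gamma.\<close>

definition bessel_J :: "real \<Rightarrow> real \<Rightarrow> real" where
  "bessel_J \<nu> x =
     (\<Sum>k. (-1) ^ k / fact k * rGamma (real k + \<nu> + 1) * (x / 2) powr (2 * real k + \<nu>))"

definition bessel_Y_quotient :: "real \<Rightarrow> real \<Rightarrow> real" where
  "bessel_Y_quotient \<nu> x =
     (bessel_J \<nu> x * cos (\<nu> * pi) - bessel_J (- \<nu>) x) / sin (\<nu> * pi)"

definition bessel_Y :: "real \<Rightarrow> real \<Rightarrow> real" where
  "bessel_Y \<nu> x =
     (if \<nu> \<in> \<int> then Lim (at \<nu>) (\<lambda>a. bessel_Y_quotient a x)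
      else bessel_Y_quotient \<nu> x)"

definition hankel1 :: "real \<Rightarrow> real \<Rightarrow> complex" where
  "hankel1 \<nu> x = complex_of_real (bessel_J \<nu> x) + \<i> * complex_of_real (bessel_Y \<nu> x)"

section \<open>Vacuum states\<close>

text \<open>A state is given by its mode functions \<open>(\<phi>, \<pi>)\<close> of the wave number
  \<open>k > 0\<close>; the value at \<open>k = 0\<close> is irrelevant for the integrals below.\<close>

type_synonym modes = "(real \<Rightarrow> complex) \<times> (real \<Rightarrow> complex)"

definition mu_sq :: "real \<Rightarrow> real \<Rightarrow> real" where
  "mu_sq m H = 3/2 - sqrt (9/4 - m\<^sup>2 / H\<^sup>2)"

definition bd_order :: "real \<Rightarrow> real \<Rightarrow> real" where
  "bd_order m H = 3/2 - mu_sq m H"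

definition bunch_davies :: "real \<Rightarrow> real \<Rightarrow> modes" where
  "bunch_davies m H =
     ((\<lambda>k. complex_of_real (sqrt (pi / (4 * H))) * hankel1 (bd_order m H) (k / H)),
      (\<lambda>k. - complex_of_real (sqrt (pi * H / 4)) *
            (complex_of_real (mu_sq m H) * hankel1 (bd_order m H) (k / H)
             + complex_of_real (k / H) * hankel1 (bd_order m H - 1) (k / H))))"

definition minkowski :: modes where
  "minkowski =
     ((\<lambda>k. complex_of_real (1 / sqrt (2 * k))),
      (\<lambda>k. - \<i> * complex_of_real (sqrt (k / 2))))"

definition fourier :: "(space \<Rightarrow> real) \<Rightarrow> space \<Rightarrow> complex" where
  "fourier f k = (LINT x|lborel. complex_of_real (f x) * exp (- (\<i> * complex_of_real (k \<bullet> x))))"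

definition mode_amplitude :: "modes \<Rightarrow> smearing \<Rightarrow> space \<Rightarrow> complex" where
  "mode_amplitude s \<gamma> k =
     fourier (snd \<gamma>) k * fst s (norm k) - fourier (fst \<gamma>) k * snd s (norm k)"

definition anticommutator_vev :: "modes \<Rightarrow> smearing \<Rightarrow> smearing \<Rightarrow> real" where
  "anticommutator_vev s \<gamma> \<gamma>' =
     2 * Re (LINT k|lborel.
        mode_amplitude s \<gamma> k * cnj (mode_amplitude s \<gamma>' k) / complex_of_real ((2 * pi) ^ 3))"

section \<open>Entropy of a single mode\<close>

definition covariance :: "modes \<Rightarrow> (2 \<Rightarrow> smearing) \<Rightarrow> real ^ 2 ^ 2" where
  "covariance s \<gamma> = (\<chi> i j. anticommutator_vev s (\<gamma> i) (\<gamma> j))"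

definition symplectic_eigenvalue :: "modes \<Rightarrow> (2 \<Rightarrow> smearing) \<Rightarrow> real" where
  "symplectic_eigenvalue s \<gamma> = sqrt (det (covariance s \<gamma>))"

text \<open>At \<open>\<nu> = 1\<close> the second term is \<open>0 * log 2 0 = 0\<close>.\<close>

definition entropy_fn :: "real \<Rightarrow> real" where
  "entropy_fn \<nu> =
     (\<nu> + 1) / 2 * log 2 ((\<nu> + 1) / 2) - (\<nu> - 1) / 2 * log 2 ((\<nu> - 1) / 2)"

definition mode_entropy :: "modes \<Rightarrow> (2 \<Rightarrow> smearing) \<Rightarrow> real" where
  "mode_entropy s \<gamma> = entropy_fn (symplectic_eigenvalue s \<gamma>)"

end

theory Submission
  imports Defs "HOL-Real_Asymp.Real_Asymp"
begin

text \<open>Rescaling momenta turns the mode of size \<open>R\<close> in the state with parameters \<open>(m, H)\<close> into the mode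
  of size \<open>1\<close> in the state with parameters \<open>(m R, H R)\<close> and leaves the Minkowski state unchanged. So
  the Minkowski entropy is a constant, and it suffices that the determinant of the Bunch-Davies
  covariance matrix tends to infinity with \<open>L = H R\<close>.

  That determinant is a Gram determinant of two amplitudes in \<open>L\<^sup>2(\<real>\<^sup>3)\<close>, hence invariant under
  unimodular changes of the two observables. With \<open>n\<close> the order of the Hankel function, an amplitude is
  \<open>L\<^bsup>n-1/2\<^esup> (F u + (3/2 - n) L G u + G w / L)\<close>, where \<open>F\<close>, \<open>G\<close> are the Fourier transforms of the
  profiles and \<open>u \<rightarrow> c k\<^bsup>-n\<^esup>\<close>, \<open>w \<rightarrow> c' k\<^bsup>2-n\<^esup>\<close> as \<open>L \<rightarrow> \<infinity>\<close>. After removing multiples of one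
  amplitude from the other, the leading terms are linearly independent, and the determinant
  grows like \<open>L\<close> to the power \<open>4n + 2\<close>, \<open>4n\<close>, \<open>4n - 2\<close> or \<open>4n - 4\<close>, according to the linear dependences among the
  profiles. The last exponent is positive because \<open>n > 1\<close> when \<open>m < H\<close>.\<close>

section \<open>Bessel functions\<close>

text \<open>The limit is taken under momentum integrals, so a majorant uniform in L is required on
  all of momentum space, including the region of large k/L, about which the small-argument behaviour
  says nothing. A crude bound is enough there: an energy estimate lets the Hankel functions grow at
  most polynomially, while the transforms of smooth profiles decay faster than any power. At the
  origin the majorant is |k|^(-n), square integrable in three dimensions exactly because n < 3/2;
  this is where a positive mass enters, and it also makes the coefficient 3/2 - n of the leading
  term nonzero. The range 1 < n < 3/2 keeps n and n - 1 off the integers, so that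
  \<open>bessel_Y\<close> is an explicit quotient and everything reduces to \<open>bessel_J\<close>.
  Independence of the limits is traced back to the profiles: every combination that has to be tested
  is the Fourier transform of a test function times a radial factor with zeros on finitely many
  spheres, and a test function is determined by its transform. Only real combinations occur, since
  the covariance matrix keeps real parts.\<close>

definition bessel_coeff :: "real \<Rightarrow> nat \<Rightarrow> real" where
  "bessel_coeff \<nu> k = (-1) ^ k / fact k * rGamma (real k + \<nu> + 1)"

text \<open>The factor of J_\<nu>(x) that remains after splitting off (x/2)^\<nu>, as a function of
  t = (x/2)^2. It is a power series convergent everywhere, for negative orders too, so derivatives
  and the value at zero come from power series alone.\<close>

definition bessel_entire :: "real \<Rightarrow> real \<Rightarrow> real" where
  "bessel_entire \<nu> t = (\<Sum>k. bessel_coeff \<nu> k * t ^ k)"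

lemma sign_fact_Suc: "(- 1) ^ Suc k / fact (Suc k) = - ((- 1) ^ k / fact k) / (real k + 1)"
proof -
  have "fact (Suc k) = (real k + 1) * fact k" by simp
  then show ?thesis by (simp only: power_Suc) simp
qed

text \<open>The functional equation of the reciprocal Gamma function, kept free of division so that
  it stays valid when k + \<nu> + 1 = 0.\<close>

lemma bessel_coeff_Suc:
  "(real k + \<nu> + 1) * (real k + 1) * bessel_coeff \<nu> (Suc k) = - bessel_coeff \<nu> k"
proof -
  have "(real k + \<nu> + 1) * rGamma (real k + \<nu> + 1 + 1) = rGamma (real k + \<nu> + 1)"
    by (rule rGamma_plus1)
  then have "rGamma (real k + \<nu> + 1) = (real k + \<nu> + 1) * rGamma (real (Suc k) + \<nu> + 1)"
    by (simp add: add_ac)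
  then show ?thesis
    unfolding bessel_coeff_def sign_fact_Suc by simp
qed

lemma summable_bessel_entire: "summable (\<lambda>k. bessel_coeff \<nu> k * t ^ k)"
proof -
  \<comment> \<open>From N on, one factor of the recursion is at least 1 and the other at least
    2|t|, so consecutive terms have ratio at most 1/2.\<close>
  obtain N where N: "2 * \<bar>t\<bar> + \<bar>\<nu>\<bar> < real N"
    using reals_Archimedean2 by blast
  have "norm (bessel_coeff \<nu> (Suc k) * t ^ Suc k) \<le> 1/2 * norm (bessel_coeff \<nu> k * t ^ k)"
    if "k \<ge> N" for k
  proof -
    have k: "2 * \<bar>t\<bar> + \<bar>\<nu>\<bar> < real k" using that N by linarith
    then have p: "1 \<le> real k + \<nu> + 1" "2 * \<bar>t\<bar> \<le> real k + 1" by linarith+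
    have "2 * \<bar>t\<bar> \<le> (real k + \<nu> + 1) * (real k + 1)"
      using mult_mono[OF p] p by simp
    then have "2 * \<bar>t\<bar> * \<bar>bessel_coeff \<nu> (Suc k)\<bar>
        \<le> (real k + \<nu> + 1) * (real k + 1) * \<bar>bessel_coeff \<nu> (Suc k)\<bar>"
      by (rule mult_right_mono) simp
    also have "\<dots> = \<bar>(real k + \<nu> + 1) * (real k + 1) * bessel_coeff \<nu> (Suc k)\<bar>"
      using p by (simp add: abs_mult)
    also have "\<dots> = \<bar>bessel_coeff \<nu> k\<bar>" by (simp add: bessel_coeff_Suc)
    finally have "2 * \<bar>t\<bar> * \<bar>bessel_coeff \<nu> (Suc k)\<bar> * \<bar>t\<bar> ^ k \<le> \<bar>bessel_coeff \<nu> k\<bar> * \<bar>t\<bar> ^ k"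
      by (rule mult_right_mono) simp
    then show ?thesis by (simp add: abs_mult power_abs mult_ac)
  qed
  then show ?thesis by (intro summable_ratio_test[of "1/2" N]) auto
qed

lemma has_field_derivative_bessel_entire:
  "(bessel_entire \<nu> has_field_derivative - bessel_entire (\<nu> + 1) t) (at t)"
proof -
  have "diffs (bessel_coeff \<nu>) k = - bessel_coeff (\<nu> + 1) k" for k
    unfolding diffs_def bessel_coeff_def sign_fact_Suc by (simp add: add_ac)
  moreover have "((\<lambda>x. \<Sum>k. bessel_coeff \<nu> k * x ^ k) has_field_derivative
      (\<Sum>k. diffs (bessel_coeff \<nu>) k * t ^ k)) (at t)"
    by (rule termdiffs_strong_converges_everywhere) (rule summable_bessel_entire)
  ultimately show ?thesis
    using suminf_minus[OF summable_bessel_entire[of "\<nu> + 1" t]]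
    by (simp add: bessel_entire_def[abs_def])
qed

text \<open>The functional equation puts a factor k + \<nu> + 1 into each coefficient. The constant
  \<nu> + 1 yields the first series; the part k removes the term k = 0 and yields the second after
  an index shift.\<close>

lemma bessel_entire_contiguous:
  "bessel_entire \<nu> t = (\<nu> + 1) * bessel_entire (\<nu> + 1) t - t * bessel_entire (\<nu> + 2) t"
proof -
  have c: "bessel_coeff \<nu> k = (\<nu> + 1) * bessel_coeff (\<nu> + 1) k + real k * bessel_coeff (\<nu> + 1) k" for k
  proof -
    have "rGamma (real k + \<nu> + 1) = (real k + \<nu> + 1) * rGamma (real k + (\<nu> + 1) + 1)"
      using rGamma_plus1[of "real k + \<nu> + 1"] by (simp add: add_ac)
    then show ?thesis unfolding bessel_coeff_def by (simp add: field_simps)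
  qed
  have shift: "bessel_coeff (\<nu> + 1) (Suc k) * real (Suc k) = - bessel_coeff (\<nu> + 2) k" for k
    unfolding bessel_coeff_def sign_fact_Suc by (simp add: add_ac)
  have "(\<lambda>k. - t * (bessel_coeff (\<nu> + 2) k * t ^ k)) sums (- t * bessel_entire (\<nu> + 2) t)"
    unfolding bessel_entire_def by (intro sums_mult summable_sums summable_bessel_entire)
  also have "(\<lambda>k. - t * (bessel_coeff (\<nu> + 2) k * t ^ k))
     = (\<lambda>k. bessel_coeff (\<nu> + 1) (Suc k) * real (Suc k) * t ^ Suc k)"
    unfolding shift by (simp add: mult_ac)
  finally have 1: "(\<lambda>k. bessel_coeff (\<nu> + 1) k * real k * t ^ k) sums (- t * bessel_entire (\<nu> + 2) t)"
    using sums_Suc_iff[of "\<lambda>k. bessel_coeff (\<nu> + 1) k * real k * t ^ k"] by simp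
  have "(\<lambda>k. (\<nu> + 1) * (bessel_coeff (\<nu> + 1) k * t ^ k)) sums ((\<nu> + 1) * bessel_entire (\<nu> + 1) t)"
    unfolding bessel_entire_def by (intro sums_mult summable_sums summable_bessel_entire)
  from sums_add[OF this 1] have "(\<lambda>k. bessel_coeff \<nu> k * t ^ k) sums
      ((\<nu> + 1) * bessel_entire (\<nu> + 1) t - t * bessel_entire (\<nu> + 2) t)"
    by (simp add: c algebra_simps)
  then show ?thesis unfolding bessel_entire_def by (simp add: sums_iff)
qed

lemma bessel_J_eq_entire:
  assumes "x > 0"
  shows "bessel_J \<nu> x = (x / 2) powr \<nu> * bessel_entire \<nu> ((x / 2)\<^sup>2)"
proof -
  have "(x / 2) powr (2 * real k + \<nu>) = (x / 2) powr \<nu> * ((x / 2)\<^sup>2) ^ k" for k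
  proof -
    have "(x / 2) powr (2 * real k) = (x / 2) ^ (2 * k)"
      using assms powr_realpow[of "x/2" "2 * k"] by simp
    then show ?thesis by (simp add: powr_add power_mult)
  qed
  then have "bessel_J \<nu> x = (\<Sum>k. (x / 2) powr \<nu> * (bessel_coeff \<nu> k * ((x / 2)\<^sup>2) ^ k))"
    unfolding bessel_J_def bessel_coeff_def by (simp add: mult_ac)
  then show ?thesis
    unfolding bessel_entire_def by (simp add: suminf_mult summable_bessel_entire)
qed

text \<open>A convention: \<open>0 powr a = 0\<close> for every a, negative ones included. The power
  bounds below can therefore include x = 0.\<close>

lemma bessel_J_0 [simp]: "bessel_J \<nu> 0 = 0"
  unfolding bessel_J_def by simp

lemma bessel_J_recurrence:
  assumes "x > 0"
  shows "bessel_J \<nu> x = 2 * (\<nu> + 1) / x * bessel_J (\<nu> + 1) x - bessel_J (\<nu> + 2) x"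
proof -
  define y where "y = x / 2"
  have y: "y > 0" and x: "x = 2 * y" using assms by (simp_all add: y_def)
  have p: "y powr (\<nu> + 1) = y * y powr \<nu>" "y powr (\<nu> + 2) = y\<^sup>2 * y powr \<nu>"
    using y by (simp_all add: powr_add)
  have "bessel_J \<nu> x = y powr \<nu> * ((\<nu> + 1) * bessel_entire (\<nu> + 1) (y\<^sup>2)
      - y\<^sup>2 * bessel_entire (\<nu> + 2) (y\<^sup>2))"
    using bessel_entire_contiguous[of \<nu> "y\<^sup>2"] assms by (simp add: bessel_J_eq_entire x)
  also have "\<dots> = 2 * (\<nu> + 1) / x * bessel_J (\<nu> + 1) x - bessel_J (\<nu> + 2) x"
    using y by (simp add: bessel_J_eq_entire x p right_diff_distrib)
  finally show ?thesis .
qed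

lemma has_field_derivative_bessel_J:
  assumes "x > 0"
  shows "(bessel_J \<nu> has_field_derivative \<nu> / x * bessel_J \<nu> x - bessel_J (\<nu> + 1) x) (at x)"
proof -
  have d: "((\<lambda>x. bessel_entire \<nu> ((x / 2)\<^sup>2)) has_field_derivative
      - bessel_entire (\<nu> + 1) ((x / 2)\<^sup>2) * (x / 2)) (at x)"
    by (rule DERIV_chain2[OF has_field_derivative_bessel_entire])
       (auto intro!: derivative_eq_intros simp: power2_eq_square)
  have p: "((\<lambda>x. (x / 2) powr \<nu>) has_field_derivative \<nu> / x * (x / 2) powr \<nu>) (at x)"
    using assms by (auto intro!: derivative_eq_intros simp: powr_diff field_simps)
  have "((\<lambda>x. (x / 2) powr \<nu> * bessel_entire \<nu> ((x / 2)\<^sup>2)) has_field_derivative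
      \<nu> / x * bessel_J \<nu> x - bessel_J (\<nu> + 1) x) (at x)"
    by (rule DERIV_cong[OF DERIV_mult[OF p d]])
       (use assms in \<open>simp add: bessel_J_eq_entire powr_add mult_ac\<close>)
  then show ?thesis
    by (rule has_field_derivative_transform_within_open[where S = "{0<..}"])
       (use assms in \<open>auto simp: bessel_J_eq_entire\<close>)
qed

text \<open>The recurrence eliminates the order \<nu> + 2, so that the orders \<nu> and \<nu> + 1
  form a closed first-order system.\<close>

lemma has_field_derivative_bessel_J_Suc:
  assumes "x > 0"
  shows "(bessel_J (\<nu> + 1) has_field_derivative
    bessel_J \<nu> x - (\<nu> + 1) / x * bessel_J (\<nu> + 1) x) (at x)"
proof -
  have "(\<nu> + 1) / x * bessel_J (\<nu> + 1) x - bessel_J (\<nu> + 1 + 1) x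
      = bessel_J \<nu> x - (\<nu> + 1) / x * bessel_J (\<nu> + 1) x"
    using bessel_J_recurrence[OF assms, of \<nu>] by (simp add: add_ac field_simps)
  then show ?thesis
    using has_field_derivative_bessel_J[OF assms, of "\<nu> + 1"] by (simp only:)
qed

text \<open>The first-order system for \<open>(J\<^sub>\<nu>, J\<^sub>\<nu>\<^sub>+\<^sub>1)\<close> is a rotation up to \<open>O(1/x)\<close>, so the
  energy \<open>J\<^sub>\<nu>\<^sup>2 + J\<^sub>\<nu>\<^sub>+\<^sub>1\<^sup>2\<close> grows at most polynomially.\<close>

lemma bessel_J_energy_bound:
  assumes "x \<ge> 1" "\<bar>\<nu>\<bar> \<le> M" "\<bar>\<nu> + 1\<bar> \<le> M"
  shows "(bessel_J \<nu> x)\<^sup>2 + (bessel_J (\<nu> + 1) x)\<^sup>2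
    \<le> ((bessel_J \<nu> 1)\<^sup>2 + (bessel_J (\<nu> + 1) 1)\<^sup>2) * x powr (2 * M)"
proof -
  define E where "E = (\<lambda>x. (bessel_J \<nu> x)\<^sup>2 + (bessel_J (\<nu> + 1) x)\<^sup>2)"
  define g where "g = (\<lambda>x. E x * x powr (- (2 * M)))"
  have dg: "\<exists>y. (g has_real_derivative y) (at x) \<and> y \<le> 0" if "1 \<le> x" for x
  proof -
    have x: "x > 0" using that by simp
    define P where "P = bessel_J \<nu> x"
    define Q where "Q = bessel_J (\<nu> + 1) x"
    define e where "e = 2 * P * (\<nu> / x * P - Q) + 2 * Q * (P - (\<nu> + 1) / x * Q)"
    have "(E has_real_derivative e) (at x)"
      unfolding E_def e_def P_def Q_def
      by (auto intro!: derivative_eq_intros has_field_derivative_bessel_J[OF x]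
           has_field_derivative_bessel_J_Suc[OF x])
    moreover have "((\<lambda>x. x powr (- (2 * M))) has_real_derivative - (2 * M) / x * x powr (- (2 * M))) (at x)"
      using x by (auto intro!: derivative_eq_intros simp: powr_diff field_simps)
    ultimately have "(g has_real_derivative e * x powr (- (2 * M)) + - (2 * M) / x * x powr (- (2 * M)) * E x) (at x)"
      unfolding g_def by (rule DERIV_mult)
    moreover have "E x = P\<^sup>2 + Q\<^sup>2" by (simp add: E_def P_def Q_def)
    moreover have "e * w + - (2 * M) / x * w * E = (e - 2 * M / x * E) * w" for w E
      by (simp add: left_diff_distrib)
    ultimately have "(g has_real_derivative (e - 2 * M / x * (P\<^sup>2 + Q\<^sup>2)) * x powr (- (2 * M))) (at x)"
      by simp
    \<comment> \<open>The rotation contributes -2PQ + 2QP = 0. Only terms of order 1/x survive, and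
      the bounds by \<open>M\<close> fix their signs.\<close>
    moreover have "(e - 2 * M / x * (P\<^sup>2 + Q\<^sup>2)) = 2 / x * ((\<nu> - M) * P\<^sup>2 - (\<nu> + 1 + M) * Q\<^sup>2)"
      using x by (simp add: e_def field_simps power2_eq_square)
    moreover have "(\<nu> - M) * P\<^sup>2 \<le> 0" "(\<nu> + 1 + M) * Q\<^sup>2 \<ge> 0"
      using assms by (auto simp: mult_le_0_iff)
    then have "2 / x * ((\<nu> - M) * P\<^sup>2 - (\<nu> + 1 + M) * Q\<^sup>2) \<le> 0"
      using x by (intro mult_nonneg_nonpos) auto
    ultimately show ?thesis by (metis mult_nonpos_nonneg powr_ge_zero)
  qed
  have "g x \<le> g 1"
    using DERIV_nonpos_imp_nonincreasing[of 1 x g] dg assms(1) by auto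
  then show ?thesis
    using assms(1) by (simp add: g_def E_def powr_minus field_simps)
qed

text \<open>On (0,1] the entire factor is bounded by compactness; beyond 1 the energy estimate with
  M = 2 bounds the square by a multiple of x^4. The alternative in the hypothesis lets the order be
  either member of the pair in the energy, so that both signs of an order up to 2 are
  covered.\<close>

lemma bessel_J_bound:
  assumes "\<bar>\<nu>\<bar> \<le> 2" "\<bar>\<nu> + 1\<bar> \<le> 2 \<or> \<bar>\<nu> - 1\<bar> \<le> 2"
  shows "\<exists>C\<ge>0. \<forall>x\<ge>0. \<bar>bessel_J \<nu> x\<bar> \<le> C * (x powr \<nu> + x\<^sup>2)"
proof -
  have "\<exists>C\<ge>0. \<forall>x\<ge>1. \<bar>bessel_J \<nu> x\<bar> \<le> C * x\<^sup>2"
  proof -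
    have "\<exists>D\<ge>0. \<forall>x\<ge>1. (bessel_J \<nu> x)\<^sup>2 \<le> D * x powr 4"
      using assms(2)
    proof
      assume a: "\<bar>\<nu> + 1\<bar> \<le> 2"
      have "(bessel_J \<nu> x)\<^sup>2 \<le> ((bessel_J \<nu> 1)\<^sup>2 + (bessel_J (\<nu> + 1) 1)\<^sup>2) * x powr 4" if "x \<ge> 1" for x
        using bessel_J_energy_bound[OF that assms(1) a] by (simp add: add_increasing2 le_diff_eq order_trans[rotated])
      then show ?thesis by (intro exI[of _ "(bessel_J \<nu> 1)\<^sup>2 + (bessel_J (\<nu> + 1) 1)\<^sup>2"]) auto
    next
      assume a: "\<bar>\<nu> - 1\<bar> \<le> 2"
      have "(bessel_J \<nu> x)\<^sup>2 \<le> ((bessel_J (\<nu> - 1) 1)\<^sup>2 + (bessel_J \<nu> 1)\<^sup>2) * x powr 4" if "x \<ge> 1" for x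
        using bessel_J_energy_bound[OF that a] assms(1) by (simp add: order_trans[rotated])
      then show ?thesis by (intro exI[of _ "(bessel_J (\<nu> - 1) 1)\<^sup>2 + (bessel_J \<nu> 1)\<^sup>2"]) auto
    qed
    then obtain D where D: "D \<ge> 0" "\<And>x. x \<ge> 1 \<Longrightarrow> (bessel_J \<nu> x)\<^sup>2 \<le> D * x powr 4" by blast
    have "\<bar>bessel_J \<nu> x\<bar> \<le> sqrt D * x\<^sup>2" if "x \<ge> 1" for x
    proof -
      have "\<bar>bessel_J \<nu> x\<bar> = sqrt ((bessel_J \<nu> x)\<^sup>2)" by simp
      also have "\<dots> \<le> sqrt (D * x powr 4)" using D(2)[OF that] by (rule real_sqrt_le_mono)
      also have "x powr 4 = (x\<^sup>2)\<^sup>2" using that by simp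
      finally show ?thesis using that by (simp only: real_sqrt_mult real_sqrt_abs) simp
    qed
    then show ?thesis using D(1) by (intro exI[of _ "sqrt D"]) auto
  qed
  then obtain C where C: "C \<ge> 0" "\<And>x. x \<ge> 1 \<Longrightarrow> \<bar>bessel_J \<nu> x\<bar> \<le> C * x\<^sup>2" by blast
  have "continuous_on {0..1} (bessel_entire \<nu>)"
    by (intro continuous_at_imp_continuous_on ballI DERIV_isCont)
       (rule has_field_derivative_bessel_entire)
  then have "bounded (bessel_entire \<nu> ` {0..1})"
    by (intro compact_imp_bounded compact_continuous_image) auto
  then obtain B where B: "\<And>t. t \<in> {0..1} \<Longrightarrow> \<bar>bessel_entire \<nu> t\<bar> \<le> B"
    unfolding bounded_iff real_norm_def by blast
  have B0: "B \<ge> 0" using B[of 0] by (meson abs_ge_zero order_trans atLeastAtMost_iff order_refl zero_le_one)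
  define K where "K = C + (1/2) powr \<nu> * B"
  have "\<bar>bessel_J \<nu> x\<bar> \<le> K * (x powr \<nu> + x\<^sup>2)" if x: "x \<ge> 0" for x
  proof -
    consider "x = 0" | "0 < x" "x \<le> 1" | "x \<ge> 1" using x by linarith
    then show ?thesis
    proof cases
      case 2
      have "\<bar>bessel_J \<nu> x\<bar> = (1/2) powr \<nu> * \<bar>bessel_entire \<nu> ((x / 2)\<^sup>2)\<bar> * x powr \<nu>"
        using 2 by (simp add: bessel_J_eq_entire abs_mult powr_divide)
      also have "\<dots> \<le> (1/2) powr \<nu> * B * x powr \<nu>"
        using 2 by (intro mult_right_mono mult_left_mono B) (auto simp: power_le_one)
      also have "\<dots> \<le> K * (x powr \<nu> + x\<^sup>2)"
        unfolding K_def using C B0 by (intro mult_mono) auto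
      finally show ?thesis .
    next
      case 3
      have "\<bar>bessel_J \<nu> x\<bar> \<le> C * x\<^sup>2" using C(2)[OF 3] .
      also have "\<dots> \<le> K * (x powr \<nu> + x\<^sup>2)"
        unfolding K_def using C B0 by (intro mult_mono) auto
      finally show ?thesis .
    qed simp
  qed
  moreover have "K \<ge> 0" unfolding K_def using C B0 by simp
  ultimately show ?thesis by blast
qed

lemma borel_measurable_bessel_J [measurable]: "bessel_J \<nu> \<in> borel_measurable borel"
  unfolding bessel_J_def by measurable

section \<open>Hankel functions: behaviour at the origin and a global bound\<close>

lemma tendsto_bessel_entire:
  "((\<lambda>x. bessel_entire \<nu> ((x / 2)\<^sup>2)) \<longlongrightarrow> rGamma (\<nu> + 1)) (at_right 0)"
proof -
  have "isCont (\<lambda>x. bessel_entire \<nu> ((x / 2)\<^sup>2)) 0"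
    by (rule isCont_o2[where g = "bessel_entire \<nu>"])
       (auto intro!: DERIV_isCont[OF has_field_derivative_bessel_entire])
  then have "((\<lambda>x. bessel_entire \<nu> ((x / 2)\<^sup>2)) \<longlongrightarrow> bessel_entire \<nu> 0) (at 0)"
    by (simp add: isCont_def)
  moreover have "bessel_entire \<nu> 0 = rGamma (\<nu> + 1)"
    unfolding bessel_entire_def by (simp only: powser_zero) (simp add: bessel_coeff_def)
  ultimately show ?thesis by (auto intro: tendsto_mono[rotated] at_le)
qed

text \<open>The order of growth at the origin is that of the \<open>J\<^sub>-\<^sub>\<nu>\<close> contained in \<open>Y\<^sub>\<nu>\<close>.\<close>

lemma tendsto_hankel1:
  assumes "\<nu> > 0" "\<nu> \<notin> \<int>"
  shows "((\<lambda>x. complex_of_real (x powr \<nu>) * hankel1 \<nu> x) \<longlongrightarrow>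
    - \<i> * complex_of_real (2 powr \<nu> * rGamma (1 - \<nu>) / sin (\<nu> * pi))) (at_right 0)"
proof -
  \<comment> \<open>Multiplied by x^\<nu>, the function of order \<nu> carries x^(2 \<nu>) and
    disappears, while the one of order -\<nu> tends to a constant.\<close>
  have pw: "((\<lambda>x::real. x powr (2 * \<nu>)) \<longlongrightarrow> 0) (at_right 0)"
    using assms(1) by (intro tendsto_zero_powrI[where b = "2 * \<nu>"]) (auto simp: eventually_at_filter tendsto_ident_at)
  have "((\<lambda>x. (1/2) powr \<nu> * x powr (2 * \<nu>) * bessel_entire \<nu> ((x / 2)\<^sup>2)) \<longlongrightarrow>
      (1/2) powr \<nu> * 0 * rGamma (\<nu> + 1)) (at_right 0)"
    by (intro tendsto_mult tendsto_const pw tendsto_bessel_entire)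
  then have "((\<lambda>x. (1/2) powr \<nu> * x powr (2 * \<nu>) * bessel_entire \<nu> ((x / 2)\<^sup>2)) \<longlongrightarrow> 0) (at_right 0)"
    by simp
  then have J: "((\<lambda>x. x powr \<nu> * bessel_J \<nu> x) \<longlongrightarrow> 0) (at_right 0)"
    by (rule Lim_transform_eventually)
       (auto simp: eventually_at_filter bessel_J_eq_entire powr_divide powr_add[symmetric])
  have "((\<lambda>x. 2 powr \<nu> * bessel_entire (- \<nu>) ((x / 2)\<^sup>2)) \<longlongrightarrow>
      2 powr \<nu> * rGamma (1 - \<nu>)) (at_right 0)"
    using tendsto_bessel_entire[of "- \<nu>"] by (intro tendsto_intros) simp
  then have Jm: "((\<lambda>x. x powr \<nu> * bessel_J (- \<nu>) x) \<longlongrightarrow> 2 powr \<nu> * rGamma (1 - \<nu>)) (at_right 0)"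
    by (rule Lim_transform_eventually)
       (auto simp: eventually_at_filter bessel_J_eq_entire powr_divide powr_minus field_simps)
  have "((\<lambda>x. complex_of_real (x powr \<nu> * bessel_J \<nu> x) + \<i> * complex_of_real
      ((x powr \<nu> * bessel_J \<nu> x * cos (\<nu> * pi) - x powr \<nu> * bessel_J (- \<nu>) x) * (1 / sin (\<nu> * pi)))) \<longlongrightarrow>
      complex_of_real 0 + \<i> * complex_of_real ((0 * cos (\<nu> * pi) - 2 powr \<nu> * rGamma (1 - \<nu>)) * (1 / sin (\<nu> * pi)))) (at_right 0)"
    by (intro tendsto_intros J Jm)
  then show ?thesis
    using assms(2)
    by (simp add: hankel1_def bessel_Y_def bessel_Y_quotient_def algebra_simps diff_divide_distrib)
qed

text \<open>At non-integer order \<open>bessel_Y\<close> is a fixed combination of the orders \<nu>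
  and -\<nu>. The power x^\<nu> of the former is absorbed by x^(-\<nu>) below 1 and, as \<nu> is at
  most 2, by x^2 above 1.\<close>

lemma hankel1_bound:
  assumes "0 < \<nu>" "\<nu> \<le> 2" "\<nu> \<notin> \<int>"
  shows "\<exists>C\<ge>0. \<forall>x\<ge>0. norm (hankel1 \<nu> x) \<le> C * (x powr (- \<nu>) + x\<^sup>2)"
proof -
  obtain A where A: "A \<ge> 0" "\<And>x. x \<ge> 0 \<Longrightarrow> \<bar>bessel_J \<nu> x\<bar> \<le> A * (x powr \<nu> + x\<^sup>2)"
    using bessel_J_bound[of \<nu>] assms by force
  obtain B where B: "B \<ge> 0" "\<And>x. x \<ge> 0 \<Longrightarrow> \<bar>bessel_J (-\<nu>) x\<bar> \<le> B * (x powr (-\<nu>) + x\<^sup>2)"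
    using bessel_J_bound[of "-\<nu>"] assms by force
  define s where "s = 1 / \<bar>sin (\<nu> * pi)\<bar>"
  have s: "s \<ge> 0" by (simp add: s_def)
  have "norm (hankel1 \<nu> x) \<le> (2 * A + 2 * A * s + B * s) * (x powr (- \<nu>) + x\<^sup>2)" if x: "x \<ge> 0" for x
  proof -
    have "x powr \<nu> \<le> x powr (-\<nu>) + x\<^sup>2"
    proof -
      consider "x = 0" | "0 < x" "x \<le> 1" | "x \<ge> 1" using x by linarith
      then show ?thesis
      proof cases
        case 2
        have "x powr \<nu> \<le> x powr (- \<nu>)" using 2 assms by (intro powr_mono') auto
        then show ?thesis by (simp add: add_increasing2)
      next
        case 3
        have "x powr \<nu> \<le> x powr 2" using 3 assms by (intro powr_mono) auto
        then show ?thesis using 3 by (simp add: add_increasing)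
      qed simp
    qed
    then have "A * (x powr \<nu> + x\<^sup>2) \<le> A * (2 * (x powr (- \<nu>) + x\<^sup>2))"
      by (intro mult_left_mono A) (smt (verit) powr_ge_zero zero_le_power2)
    then have J: "\<bar>bessel_J \<nu> x\<bar> \<le> 2 * A * (x powr (- \<nu>) + x\<^sup>2)"
      using A(2)[OF x] by (simp only: mult_ac)
    have "\<bar>bessel_J \<nu> x * cos (\<nu> * pi)\<bar> \<le> \<bar>bessel_J \<nu> x\<bar> * 1"
      unfolding abs_mult by (intro mult_left_mono) auto
    then have "\<bar>bessel_J \<nu> x * cos (\<nu> * pi) - bessel_J (- \<nu>) x\<bar>
        \<le> 2 * A * (x powr (- \<nu>) + x\<^sup>2) + B * (x powr (- \<nu>) + x\<^sup>2)"
      using J B(2)[OF x] by linarith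
    then have "\<bar>bessel_J \<nu> x * cos (\<nu> * pi) - bessel_J (- \<nu>) x\<bar> * s
        \<le> (2 * A * (x powr (- \<nu>) + x\<^sup>2) + B * (x powr (- \<nu>) + x\<^sup>2)) * s"
      using s by (rule mult_right_mono)
    moreover have "\<bar>bessel_Y \<nu> x\<bar> = \<bar>bessel_J \<nu> x * cos (\<nu> * pi) - bessel_J (- \<nu>) x\<bar> * s"
      using assms(3) by (simp add: bessel_Y_def bessel_Y_quotient_def s_def)
    moreover have "norm (hankel1 \<nu> x) \<le> \<bar>bessel_J \<nu> x\<bar> + \<bar>bessel_Y \<nu> x\<bar>"
      unfolding hankel1_def by (rule norm_triangle_le) (simp add: norm_mult)
    ultimately show ?thesis using J by (simp add: algebra_simps)
  qed
  moreover have "2 * A + 2 * A * s + B * s \<ge> 0" using A B s by simp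
  ultimately show ?thesis by blast
qed

lemma borel_measurable_hankel1:
  assumes "\<nu> \<notin> \<int>"
  shows "hankel1 \<nu> \<in> borel_measurable borel"
proof -
  have "hankel1 \<nu> = (\<lambda>x. complex_of_real (bessel_J \<nu> x) + \<i> * complex_of_real (bessel_Y_quotient \<nu> x))"
    using assms by (simp add: fun_eq_iff hankel1_def bessel_Y_def)
  then show ?thesis unfolding bessel_Y_quotient_def by simp
qed

text \<open>Another convention, in agreement with \<open>0 powr (- \<nu>) = 0\<close>; it makes the
  pointwise limits hold at zero momentum too.\<close>

lemma hankel1_0:
  assumes "\<nu> \<notin> \<int>"
  shows "hankel1 \<nu> 0 = 0"
  using assms by (simp add: hankel1_def bessel_Y_def bessel_Y_quotient_def)

section \<open>Fourier transforms of test functions\<close>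

lemma test_function_continuous:
  assumes "test_function f"
  shows "continuous_on UNIV f"
  using assms unfolding test_function_def smooth_def by (metis Ck.simps(1))

lemma test_function_bounded_support:
  assumes "test_function f"
  obtains B where "B > 0" "\<And>x. norm x > B \<Longrightarrow> f x = 0"
proof -
  have "bounded (closure {x. f x \<noteq> 0})"
    using assms unfolding test_function_def compactly_supported_def by (simp add: compact_imp_bounded)
  then obtain B where "B > 0" "\<And>x. x \<in> closure {x. f x \<noteq> 0} \<Longrightarrow> norm x \<le> B"
    unfolding bounded_pos by blast
  then have "f x = 0" if "norm x > B" for x
    using closure_subset[of "{x. f x \<noteq> 0}"] that by fastforce
  then show thesis using that \<open>B > 0\<close> by blast
qed

lemma test_function_bounded:
  assumes "test_function f"
  obtains M where "M > 0" "\<And>x. \<bar>f x\<bar> \<le> M"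
proof -
  obtain B where B: "B > 0" "\<And>x. norm x > B \<Longrightarrow> f x = 0"
    using test_function_bounded_support[OF assms] by blast
  have "compact (f ` cball 0 B)"
    by (intro compact_continuous_image continuous_on_subset[OF test_function_continuous[OF assms]]) auto
  then obtain M where M: "M > 0" "\<And>x. norm x \<le> B \<Longrightarrow> \<bar>f x\<bar> \<le> M"
    by (auto dest!: compact_imp_bounded simp: bounded_pos)
  have "\<bar>f x\<bar> \<le> M" for x
    using M B(2)[of x] by (cases "norm x \<le> B") auto
  then show thesis using that M(1) by blast
qed

lemma test_function_measurable [measurable_dest]:
  "test_function f \<Longrightarrow> f \<in> borel_measurable borel"
  by (rule borel_measurable_continuous_onI) (rule test_function_continuous)

lemma integrable_compact_support:
  fixes f :: "space \<Rightarrow> 'b::{banach,second_countable_topology}"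
  assumes "f \<in> borel_measurable borel" "\<And>x. norm (f x) \<le> M" "\<And>x. norm x > B \<Longrightarrow> f x = 0"
  shows "integrable lborel f"
proof (rule Bochner_Integration.integrable_bound)
  show "integrable lborel (\<lambda>x::space. indicator (cball 0 B) x *\<^sub>R M)"
    by (intro integrable_scaleR_left integrable_real_indicator) (simp_all add: emeasure_bounded_finite[unfolded infinity_ennreal_def])
next
  show "AE x in lborel. norm (f x) \<le> norm (indicator (cball 0 B) x *\<^sub>R M)"
  proof (intro AE_I2)
    fix x :: space
    show "norm (f x) \<le> norm (indicator (cball 0 B) x *\<^sub>R M)"
      using assms(2)[of x] assms(3)[of x] order_trans[OF norm_ge_zero assms(2)[of x]]
      by (cases "norm x \<le> B") (auto simp: indicator_def dist_norm)
  qed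
qed (use assms in simp)

lemma test_function_integrable:
  assumes "test_function f"
  shows "integrable lborel f"
proof -
  obtain B where B: "\<And>x. norm x > B \<Longrightarrow> f x = 0" using test_function_bounded_support[OF assms] by blast
  obtain M where M: "\<And>x. \<bar>f x\<bar> \<le> M" using test_function_bounded[OF assms] by blast
  show ?thesis
    by (rule integrable_compact_support[OF test_function_measurable[OF assms], of M B])
      (use B M in auto)
qed

section \<open>Derivatives of test functions and decay of their Fourier transforms\<close>

definition partial :: "3 \<Rightarrow> (space \<Rightarrow> real) \<Rightarrow> space \<Rightarrow> real" where
  "partial i f = (\<lambda>x. frechet_derivative f (at x) (axis i 1))"

lemma test_function_has_derivative:
  assumes "test_function f"
  shows "(f has_derivative frechet_derivative f (at x)) (at x)"
proof -
  have "Ck (Suc 0) f" using assms unfolding test_function_def smooth_def by blast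
  then show ?thesis by (simp add: frechet_derivative_works)
qed

text \<open>Off its closed support f vanishes on an open set, so differentiation cannot enlarge the
  support; smoothness is one level of \<open>Ck\<close>.\<close>

lemma test_function_partial:
  assumes "test_function f"
  shows "test_function (partial i f)"
proof -
  have "smooth (partial i f)"
    unfolding smooth_def
  proof
    fix k
    have "Ck (Suc k) f" using assms unfolding test_function_def smooth_def by blast
    then show "Ck k (partial i f)" unfolding partial_def by simp
  qed
  moreover have "{x. partial i f x \<noteq> 0} \<subseteq> closure {x. f x \<noteq> 0}"
  proof (rule ccontr)
    assume "\<not> ?thesis"
    then obtain x where x: "partial i f x \<noteq> 0" "x \<in> - closure {x. f x \<noteq> 0}" by auto
    have "(f has_derivative (\<lambda>_. 0)) (at x)"
    proof (rule has_derivative_transform_within_open)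
      show "((\<lambda>_. 0::real) has_derivative (\<lambda>_. 0)) (at x)" by simp
      show "open (- closure {x. f x \<noteq> 0})" by (simp add: open_Compl)
      show "0 = f y" if "y \<in> - closure {x. f x \<noteq> 0}" for y
        using that closure_subset[of "{x. f x \<noteq> 0}"] by auto
    qed (use x in auto)
    then have "frechet_derivative f (at x) = (\<lambda>_. 0)"
      by (rule has_derivative_unique[OF test_function_has_derivative[OF assms]])
    with x show False by (simp add: partial_def)
  qed
  then have "compact (closure {x. partial i f x \<noteq> 0})"
    using assms unfolding test_function_def compactly_supported_def
    by (metis closed_closure closure_minimal compact_Int_closed inf.absorb_iff2)
  ultimately show ?thesis unfolding test_function_def compactly_supported_def by simp
qed

lemma Ck_lincomb:
  assumes "Ck k f" "Ck k g"
  shows "Ck k (\<lambda>x. a * f x + b * g x)"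
  using assms
proof (induction k arbitrary: f g)
  case 0
  then show ?case by (auto intro!: continuous_intros)
next
  case (Suc k)
  have d: "((\<lambda>x. a * f x + b * g x) has_derivative
      (\<lambda>h. a * frechet_derivative f (at x) h + b * frechet_derivative g (at x) h)) (at x)" for x
    using Suc.prems
    by (intro has_derivative_add has_derivative_mult_right) (simp_all flip: frechet_derivative_works)
  have "frechet_derivative (\<lambda>x. a * f x + b * g x) (at x) h
      = a * frechet_derivative f (at x) h + b * frechet_derivative g (at x) h" for x h
    using frechet_derivative_at[OF d[of x]] by metis
  moreover have "(\<lambda>x. a * f x + b * g x) differentiable (at x)" for x
    using d[of x] unfolding differentiable_def by blast
  ultimately show ?case using Suc by simp
qed

lemma test_function_lincomb:
  assumes "test_function f" "test_function g"
  shows "test_function (\<lambda>x. a * f x + b * g x)"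
proof -
  have "{x. a * f x + b * g x \<noteq> 0} \<subseteq> closure {x. f x \<noteq> 0} \<union> closure {x. g x \<noteq> 0}"
  proof
    fix x assume "x \<in> {x. a * f x + b * g x \<noteq> 0}"
    then have "x \<in> {x. f x \<noteq> 0} \<or> x \<in> {x. g x \<noteq> 0}" by (cases "f x = 0") auto
    then show "x \<in> closure {x. f x \<noteq> 0} \<union> closure {x. g x \<noteq> 0}"
      by (metis UnI1 UnI2 closure_subset subsetD)
  qed
  moreover have c: "compact (closure {x. f x \<noteq> 0} \<union> closure {x. g x \<noteq> 0})"
    using assms unfolding test_function_def compactly_supported_def by (intro compact_Un) auto
  ultimately have "closure {x. a * f x + b * g x \<noteq> 0} \<subseteq> closure {x. f x \<noteq> 0} \<union> closure {x. g x \<noteq> 0}"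
    by (intro closure_minimal compact_imp_closed)
  then have "compact (closure {x. a * f x + b * g x \<noteq> 0})"
    using compact_Int_closed[OF c closed_closure, of "{x. a * f x + b * g x \<noteq> 0}"] by (simp only: Int_absorb1)
  then show ?thesis
    using assms Ck_lincomb unfolding test_function_def smooth_def compactly_supported_def by blast
qed

lemma partial_has_field_derivative:
  assumes "test_function f"
  shows "((\<lambda>s. f (x + s *\<^sub>R axis i 1)) has_real_derivative partial i f (x + s *\<^sub>R axis i 1)) (at s)"
proof -
  have 1: "((\<lambda>s::real. x + s *\<^sub>R axis i 1) has_derivative (\<lambda>t. t *\<^sub>R axis i 1)) (at s)"
    by (auto intro!: derivative_eq_intros)
  have "((\<lambda>s. f (x + s *\<^sub>R axis i 1)) has_derivative
      (\<lambda>t. frechet_derivative f (at (x + s *\<^sub>R axis i 1)) (t *\<^sub>R axis i 1))) (at s)"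
    by (rule has_derivative_compose[OF 1 test_function_has_derivative[OF assms]])
  moreover have "frechet_derivative f (at (x + s *\<^sub>R axis i 1)) (t *\<^sub>R axis i 1) =
      partial i f (x + s *\<^sub>R axis i 1) * t" for t
    using linear_scale[OF has_derivative_linear[OF test_function_has_derivative[OF assms]]]
    by (simp add: partial_def)
  ultimately show ?thesis by (simp add: has_field_derivative_def)
qed

abbreviation plane_wave :: "space \<Rightarrow> space \<Rightarrow> complex" where
  "plane_wave k x \<equiv> exp (- (\<i> * complex_of_real (k \<bullet> x)))"

lemma plane_wave_measurable [measurable]: "plane_wave k \<in> borel_measurable borel"
  by (intro borel_measurable_continuous_onI continuous_intros)

lemma integrable_mult_plane_wave:
  assumes "integrable lborel f"
  shows "integrable lborel (\<lambda>x. complex_of_real (f x) * plane_wave k x)"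
proof (rule Bochner_Integration.integrable_bound[OF assms])
  show "(\<lambda>x. complex_of_real (f x) * plane_wave k x) \<in> borel_measurable lborel"
    using borel_measurable_integrable[OF assms] by measurable
qed (auto simp: norm_mult)

lemma integral_lborel_translation:
  fixes f :: "space \<Rightarrow> complex"
  assumes "f \<in> borel_measurable borel"
  shows "(LINT x|lborel. f (c + x)) = (LINT x|lborel. f x)"
proof -
  have "(LINT x|lborel. f x) = (LINT x|distr lborel borel ((+) c). f x)"
    by (simp add: lborel_distr_plus)
  also have "\<dots> = (LINT x|lborel. f (c + x))"
    by (rule integral_distr) (use assms in auto)
  finally show ?thesis by simp
qed

lemma fourier_translation:
  assumes "integrable lborel f"
  shows "fourier (\<lambda>x. f (x + c)) k = exp (\<i> * complex_of_real (k \<bullet> c)) * fourier f k"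
proof -
  have [measurable]: "f \<in> borel_measurable borel"
    using borel_measurable_integrable[OF assms] by simp
  have "fourier f k = (LINT x|lborel. complex_of_real (f (c + x)) * plane_wave k (c + x))"
    unfolding fourier_def by (rule integral_lborel_translation[symmetric]) measurable
  then have "exp (\<i> * complex_of_real (k \<bullet> c)) * fourier f k =
     (LINT x|lborel. exp (\<i> * complex_of_real (k \<bullet> c)) * (complex_of_real (f (c + x)) * plane_wave k (c + x)))"
    by simp
  moreover have "exp (\<i> * complex_of_real (k \<bullet> c)) * (complex_of_real (f (c + x)) * plane_wave k (c + x))
      = complex_of_real (f (x + c)) * plane_wave k x" for x
    by (simp add: inner_add_right exp_add[symmetric] algebra_simps)
  ultimately show ?thesis unfolding fourier_def by simp
qed

lemma fourier_lincomb:
  assumes "integrable lborel f" "integrable lborel g"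
  shows "fourier (\<lambda>x. a * f x + b * g x) k = a * fourier f k + b * fourier g k"
  unfolding fourier_def
  using integrable_mult_plane_wave[OF assms(1), of k] integrable_mult_plane_wave[OF assms(2), of k]
  by (simp add: ring_distribs mult.assoc)

text \<open>Difference quotients take the place of integration by parts: a translation multiplies
  the transform by a phase, and the derivative of that phase at 0 gives the factor.\<close>

lemma fourier_partial:
  assumes "test_function f"
  shows "fourier (partial i f) k = \<i> * complex_of_real (k $ i) * fourier f k"
proof -
  define e :: space where "e = axis i 1"
  \<comment> \<open>Steps in (0,1] keep the supports of all quotients in the ball of radius B + 1;
    with the bound from the mean value theorem this gives one integrable majorant.\<close>
  define h where "h = (\<lambda>n. 1 / real (Suc n))"
  have h: "0 < h n" "h n \<le> 1" for n by (auto simp: h_def field_simps)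
  have h0: "h \<longlonglongrightarrow> 0" unfolding h_def by (rule LIMSEQ_ignore_initial_segment[of _ _ 1, simplified]) (rule lim_1_over_n)
  have hne: "filterlim h (at 0) sequentially"
    using h0 h by (auto simp: filterlim_at less_imp_neq[symmetric])
  obtain B where B: "B > 0" "\<And>x. norm x > B \<Longrightarrow> f x = 0"
    using test_function_bounded_support[OF assms] by blast
  obtain M where M: "M > 0" "\<And>x. \<bar>partial i f x\<bar> \<le> M"
    using test_function_bounded[OF test_function_partial[OF assms]] by blast
  have [measurable]: "f \<in> borel_measurable borel" "partial i f \<in> borel_measurable borel"
    using assms test_function_partial[OF assms] by (auto intro: test_function_measurable)
  define d where "d = (\<lambda>n x. (f (x + h n *\<^sub>R e) - f x) / h n)"
  have [measurable]: "d n \<in> borel_measurable borel" for n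
    unfolding d_def by measurable
  have db: "\<bar>d n x\<bar> \<le> M" for n x
  proof -
    have "\<exists>z. 0 < z \<and> z < h n \<and> f (x + h n *\<^sub>R e) - f (x + 0 *\<^sub>R e) = (h n - 0) * partial i f (x + z *\<^sub>R e)"
      unfolding e_def using h[of n] by (intro MVT2 partial_has_field_derivative[OF assms]) auto
    then obtain z where "f (x + h n *\<^sub>R e) - f x = h n * partial i f (x + z *\<^sub>R e)" by auto
    then show ?thesis unfolding d_def using h[of n] M(2) by simp
  qed
  have ds: "d n x = 0" if "norm x > B + 1" for n x
  proof -
    have "norm (h n *\<^sub>R e) \<le> 1" using h[of n] by (simp add: e_def norm_axis_1)
    then have "norm (x + h n *\<^sub>R e) > B"
      using norm_diff_ineq[of x "h n *\<^sub>R e"] that by linarith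
    then show ?thesis using that B by (simp add: d_def)
  qed
  have lim: "(\<lambda>n. d n x) \<longlonglongrightarrow> partial i f x" for x
  proof -
    have "((\<lambda>t. (f (x + t *\<^sub>R e) - f x) / t) \<longlongrightarrow> partial i f x) (at 0)"
      using partial_has_field_derivative[OF assms, of x i 0] by (simp add: DERIV_def e_def)
    then show ?thesis unfolding d_def by (rule filterlim_compose[OF _ hne])
  qed
  have "(\<lambda>n. fourier (d n) k) \<longlonglongrightarrow> fourier (partial i f) k"
    unfolding fourier_def
  proof (rule integral_dominated_convergence)
    show "integrable lborel (\<lambda>x::space. indicator (cball 0 (B + 1)) x *\<^sub>R M)"
      by (intro integrable_scaleR_left integrable_real_indicator) (simp_all add: emeasure_bounded_finite[unfolded infinity_ennreal_def])
    show "AE x in lborel. norm (complex_of_real (d n x) * plane_wave k x)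
       \<le> indicator (cball 0 (B + 1)) x *\<^sub>R M" for n
      using db[of n] ds[of _ n] by (intro AE_I2) (auto simp: norm_mult indicator_def not_le)
    show "AE x in lborel. (\<lambda>n. complex_of_real (d n x) * plane_wave k x) \<longlonglongrightarrow>
        complex_of_real (partial i f x) * plane_wave k x"
      by (intro AE_I2 tendsto_intros lim)
  qed measurable
  moreover have "fourier (d n) k = (exp (\<i> * complex_of_real (k $ i) * complex_of_real (h n)) - 1) / complex_of_real (h n) * fourier f k" for n
  proof -
    have i: "integrable lborel f" "integrable lborel (\<lambda>x. f (x + h n *\<^sub>R e))"
    proof -
      show "integrable lborel f" by (rule test_function_integrable[OF assms])
      have "integrable (distr lborel borel ((+) (h n *\<^sub>R e))) f"
        using \<open>integrable lborel f\<close> by (simp add: lborel_distr_plus)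
      then show "integrable lborel (\<lambda>x. f (x + h n *\<^sub>R e))"
        by (subst (asm) integrable_distr_eq) (auto simp: add.commute)
    qed
    have "d n = (\<lambda>x. (1 / h n) * f (x + h n *\<^sub>R e) + (- 1 / h n) * f x)"
      by (auto simp: d_def diff_divide_distrib)
    then have "fourier (d n) k = complex_of_real (1 / h n) * fourier (\<lambda>x. f (x + h n *\<^sub>R e)) k
        + complex_of_real (- 1 / h n) * fourier f k"
      by (simp only: fourier_lincomb[OF i(2) i(1)])
    then show ?thesis
      by (simp add: fourier_translation[OF i(1)] e_def inner_axis left_diff_distrib right_diff_distrib
          diff_divide_distrib mult_ac)
  qed
  moreover have "(\<lambda>n. (exp (\<i> * complex_of_real (k $ i) * complex_of_real (h n)) - 1) / complex_of_real (h n) * fourier f k)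
      \<longlonglongrightarrow> \<i> * complex_of_real (k $ i) * fourier f k"
  proof -
    have "((\<lambda>z. exp (\<i> * complex_of_real (k $ i) * z)) has_field_derivative \<i> * complex_of_real (k $ i)) (at 0)"
      by (auto intro!: derivative_eq_intros)
    then have "((\<lambda>z. (exp (\<i> * complex_of_real (k $ i) * z) - 1) / z) \<longlongrightarrow> \<i> * complex_of_real (k $ i)) (at 0)"
      by (simp add: DERIV_def)
    moreover have "filterlim (\<lambda>n. complex_of_real (h n)) (at 0) sequentially"
      using h0 h by (auto simp: filterlim_at less_imp_neq[symmetric] intro!: tendsto_eq_intros)
    ultimately show ?thesis by (intro tendsto_mult tendsto_const) (rule filterlim_compose)
  qed
  ultimately show ?thesis by (simp add: LIMSEQ_unique)
qed

lemma norm_fourier_le: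
  "norm (fourier f k) \<le> (LINT x|lborel. \<bar>f x\<bar>)"
  unfolding fourier_def
  using integral_norm_bound[of lborel "\<lambda>x. complex_of_real (f x) * plane_wave k x"]
  by (simp add: norm_mult)

text \<open>One factor |k_i| is traded for one derivative, and derivatives of test functions are
  again test functions; hence the induction over arbitrary f.\<close>

lemma fourier_component_decay:
  assumes "test_function f"
  shows "\<exists>C\<ge>0. \<forall>k. \<bar>k $ i\<bar> ^ N * norm (fourier f k) \<le> C"
  using assms
proof (induction N arbitrary: f)
  case 0
  show ?case
    by (intro exI[of _ "LINT x|lborel. \<bar>f x\<bar>"]) (auto simp: norm_fourier_le)
next
  case (Suc N)
  have "\<bar>k $ i\<bar> ^ Suc N * norm (fourier f k) = \<bar>k $ i\<bar> ^ N * norm (fourier (partial i f) k)" for k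
    by (simp add: fourier_partial[OF Suc.prems] norm_mult mult_ac)
  then show ?case using Suc.IH[OF test_function_partial[OF Suc.prems]] by presburger
qed

lemma fourier_decay:
  assumes "test_function f"
  shows "\<exists>C\<ge>0. \<forall>k. (1 + norm k) ^ N * norm (fourier f k) \<le> C"
proof -
  have "\<forall>i. \<exists>C. C \<ge> 0 \<and> (\<forall>k. \<bar>k $ i\<bar> ^ N * norm (fourier f k) \<le> C)"
    using fourier_component_decay[OF assms] by blast
  then obtain c where c: "\<And>i. c i \<ge> 0" "\<And>i k. \<bar>k $ i\<bar> ^ N * norm (fourier f k) \<le> c i"
    by metis
  define c0 where "c0 = (LINT x|lborel. \<bar>f x\<bar>)"
  have c0: "norm (fourier f k) \<le> c0" "c0 \<ge> 0" for k
    by (auto simp: c0_def norm_fourier_le)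
  have "(1 + norm k) ^ N * norm (fourier f k) \<le> 4 ^ N * (c0 + sum c UNIV)" for k
  proof -
    \<comment> \<open>Since 1 + |k| is at most 1 + 3m, it is at most 4m, the origin of 4^N. Moreover
      m is 1 or some |k_i|, so one of the constants at hand applies.\<close>
    define m where "m = Max (insert 1 (range (\<lambda>i. \<bar>k $ i\<bar>)))"
    have m1: "1 \<le> m" unfolding m_def by (rule Max_ge) auto
    have mi: "\<bar>k $ i\<bar> \<le> m" for i unfolding m_def by (rule Max_ge) auto
    have "norm k \<le> (\<Sum>i\<in>UNIV. \<bar>k $ i\<bar>)" by (rule norm_le_l1_cart)
    also have "\<dots> \<le> (\<Sum>i\<in>(UNIV::3 set). m)" by (intro sum_mono mi)
    finally have "1 + norm k \<le> 4 * m" using m1 by simp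
    then have "(1 + norm k) ^ N \<le> 4 ^ N * m ^ N"
      by (metis add_nonneg_nonneg norm_ge_zero power_mono power_mult_distrib zero_le_one)
    then have "(1 + norm k) ^ N * norm (fourier f k) \<le> 4 ^ N * m ^ N * norm (fourier f k)"
      by (rule mult_right_mono) simp
    also have "m ^ N * norm (fourier f k) \<le> c0 + sum c UNIV"
    proof -
      have "m \<in> insert 1 (range (\<lambda>i. \<bar>k $ i\<bar>))" unfolding m_def by (rule Max_in) auto
      then show ?thesis
      proof
        assume "m = 1"
        then show ?thesis using c0(1)[of k] c(1) by (simp add: add_increasing2 sum_nonneg)
      next
        assume "m \<in> range (\<lambda>i. \<bar>k $ i\<bar>)"
        then obtain i where "m = \<bar>k $ i\<bar>" by blast
        then have "m ^ N * norm (fourier f k) \<le> c i" using c(2) by simp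
        also have "\<dots> \<le> sum c UNIV" by (rule member_le_sum) (use c in auto)
        finally show ?thesis using c0(2) by linarith
      qed
    qed
    then have "4 ^ N * m ^ N * norm (fourier f k) \<le> 4 ^ N * (c0 + sum c UNIV)"
      by (simp add: mult.assoc)
    finally show ?thesis .
  qed
  moreover have "0 \<le> 4 ^ N * (c0 + sum c UNIV)" using c0(2) c(1) by (simp add: sum_nonneg)
  ultimately show ?thesis by blast
qed

lemma continuous_on_fourier:
  assumes "integrable lborel f"
  shows "continuous_on UNIV (fourier f)"
  unfolding continuous_on_sequentially
proof (intro ballI allI impI)
  fix k and u :: "nat \<Rightarrow> space"
  assume u: "(\<forall>n. u n \<in> UNIV) \<and> u \<longlonglongrightarrow> k"
  have [measurable]: "f \<in> borel_measurable borel"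
    using borel_measurable_integrable[OF assms] by simp
  show "(fourier f \<circ> u) \<longlonglongrightarrow> fourier f k"
    unfolding fourier_def o_def
  proof (rule integral_dominated_convergence)
    show "integrable lborel (\<lambda>x. \<bar>f x\<bar>)" using assms by simp
    show "AE x in lborel. (\<lambda>n. complex_of_real (f x) * plane_wave (u n) x) \<longlonglongrightarrow>
        complex_of_real (f x) * plane_wave k x"
      using u by (intro AE_I2 tendsto_intros) auto
  qed (auto simp: norm_mult)
qed

lemma fourier_measurable:
  "integrable lborel f \<Longrightarrow> fourier f \<in> borel_measurable borel"
  by (rule borel_measurable_continuous_onI) (rule continuous_on_fourier)

section \<open>Injectivity of the Fourier transform on test functions\<close>

lemma AE_zero_continuous_imp_zero:
  fixes g :: "space \<Rightarrow> 'b::real_normed_vector"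
  assumes "continuous_on UNIV g" "AE x in lborel. g x = 0"
  shows "g x = 0"
proof -
  have o: "open {x. g x \<noteq> 0}"
    using assms(1) by (simp add: open_Collect_neq continuous_on_const)
  have "{x. g x \<noteq> 0} \<in> null_sets lborel"
    using assms(2) o AE_iff_measurable[of "{x. g x \<noteq> 0}" lborel "\<lambda>x. g x = 0"] by (simp add: null_sets_def)
  then have "negligible {x. g x \<noteq> 0}"
    by (simp add: negligible_iff_null_sets null_sets_completionI)
  then have "{x. g x \<noteq> 0} = {}"
    using o open_not_negligible by blast
  then show ?thesis by blast
qed

text \<open>Functions whose integral against f involves only values of \<open>fourier f\<close>.
  They form an algebra that separates points, as Stone-Weierstrass requires.\<close>

inductive_set trig_poly :: "(space \<Rightarrow> real) set" where
  cos: "(\<lambda>x. cos (a \<bullet> x)) \<in> trig_poly"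
| sin: "(\<lambda>x. sin (a \<bullet> x)) \<in> trig_poly"
| add: "f \<in> trig_poly \<Longrightarrow> g \<in> trig_poly \<Longrightarrow> (\<lambda>x. f x + g x) \<in> trig_poly"
| cmult: "f \<in> trig_poly \<Longrightarrow> (\<lambda>x. c * f x) \<in> trig_poly"

lemma trig_poly_lincomb:
  assumes "f \<in> trig_poly" "g \<in> trig_poly"
  shows "(\<lambda>x. a * f x + b * g x) \<in> trig_poly"
  by (intro trig_poly.add trig_poly.cmult assms)

text \<open>Product-to-sum formulas: frequencies a and b turn into a + b and a - b. The nested
  inductions reduce to the generators.\<close>

lemma trig_poly_mult:
  assumes "f \<in> trig_poly" "g \<in> trig_poly"
  shows "(\<lambda>x. f x * g x) \<in> trig_poly"
  using assms(1)
proof induction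
  case (cos a)
  show ?case using assms(2)
  proof induction
    case (cos b)
    have "(\<lambda>x. cos (a \<bullet> x) * cos (b \<bullet> x)) = (\<lambda>x. 1/2 * cos ((a - b) \<bullet> x) + 1/2 * cos ((a + b) \<bullet> x))"
      by (simp add: inner_diff_left inner_add_left cos_times_cos add_divide_distrib)
    then show ?case by (simp only: trig_poly_lincomb trig_poly.cos)
  next
    case (sin b)
    have "(\<lambda>x. cos (a \<bullet> x) * sin (b \<bullet> x)) = (\<lambda>x. 1/2 * sin ((a + b) \<bullet> x) + (-1/2) * sin ((a - b) \<bullet> x))"
      by (simp add: inner_diff_left inner_add_left cos_times_sin diff_divide_distrib)
    then show ?case by (simp only: trig_poly_lincomb trig_poly.sin)
  next
    case (add g h)
    then show ?case unfolding distrib_left by (intro trig_poly.add)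
  next
    case (cmult g c)
    then show ?case unfolding mult.left_commute[of _ c] by (intro trig_poly.cmult)
  qed
next
  case (sin a)
  show ?case using assms(2)
  proof induction
    case (cos b)
    have "(\<lambda>x. sin (a \<bullet> x) * cos (b \<bullet> x)) = (\<lambda>x. 1/2 * sin ((a + b) \<bullet> x) + 1/2 * sin ((a - b) \<bullet> x))"
      by (simp add: inner_diff_left inner_add_left sin_times_cos add_divide_distrib)
    then show ?case by (simp only: trig_poly_lincomb trig_poly.sin)
  next
    case (sin b)
    have "(\<lambda>x. sin (a \<bullet> x) * sin (b \<bullet> x)) = (\<lambda>x. 1/2 * cos ((a - b) \<bullet> x) + (-1/2) * cos ((a + b) \<bullet> x))"
      by (simp add: inner_diff_left inner_add_left sin_times_sin diff_divide_distrib)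
    then show ?case by (simp only: trig_poly_lincomb trig_poly.cos)
  next
    case (add g h)
    then show ?case unfolding distrib_left by (intro trig_poly.add)
  next
    case (cmult g c)
    then show ?case unfolding mult.left_commute[of _ c] by (intro trig_poly.cmult)
  qed
next
  case (add f h)
  then show ?case unfolding distrib_right by (intro trig_poly.add)
next
  case (cmult f c)
  then show ?case unfolding mult.assoc by (intro trig_poly.cmult)
qed

lemma trig_poly_continuous: "f \<in> trig_poly \<Longrightarrow> continuous_on S f"
  by (induction rule: trig_poly.induct) (auto intro!: continuous_intros)

lemma trig_poly_bounded: "f \<in> trig_poly \<Longrightarrow> \<exists>M. \<forall>x. \<bar>f x\<bar> \<le> M"
proof (induction rule: trig_poly.induct)
  case (add f g)
  then obtain M N where "\<And>x. \<bar>f x\<bar> \<le> M" "\<And>x. \<bar>g x\<bar> \<le> N" by blast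
  then have "\<bar>f x + g x\<bar> \<le> M + N" for x
    using abs_triangle_ineq[of "f x" "g x"] add_mono[of "\<bar>f x\<bar>" M "\<bar>g x\<bar>" N] by fastforce
  then show ?case by blast
next
  case (cmult f c)
  then obtain M where "\<And>x. \<bar>f x\<bar> \<le> M" by blast
  then have "\<bar>c * f x\<bar> \<le> \<bar>c\<bar> * M" for x
    by (simp add: abs_mult mult_left_mono)
  then show ?case by blast
qed (use abs_cos_le_one abs_sin_le_one in blast)+

lemma integrable_mult_trig_poly:
  assumes "integrable lborel f" "g \<in> trig_poly"
  shows "integrable lborel (\<lambda>x. f x * g x)"
proof -
  obtain M where M: "\<And>x. \<bar>g x\<bar> \<le> M" using trig_poly_bounded[OF assms(2)] by blast
  have [measurable]: "f \<in> borel_measurable borel" "g \<in> borel_measurable borel"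
    using borel_measurable_integrable[OF assms(1)] trig_poly_continuous[OF assms(2)]
    by (auto intro: borel_measurable_continuous_onI)
  show ?thesis
  proof (rule Bochner_Integration.integrable_bound)
    show "integrable lborel (\<lambda>x. f x * M)" using assms(1) by simp
    show "AE x in lborel. norm (f x * g x) \<le> norm (f x * M)"
    proof (intro AE_I2)
      show "norm (f x * g x) \<le> norm (f x * M)" for x
        using M[of x] by (simp add: abs_mult mult_left_mono)
    qed
  qed measurable
qed

lemma integral_mult_trig_poly_eq_0:
  assumes "integrable lborel f" "\<And>k. fourier f k = 0" "g \<in> trig_poly"
  shows "(LINT x|lborel. f x * g x) = 0"
  using assms(3)
proof induction
  case (cos a)
  have "Re (fourier f a) = (LINT x|lborel. Re (complex_of_real (f x) * plane_wave a x))"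
    unfolding fourier_def by (rule integral_Re[symmetric]) (rule integrable_mult_plane_wave[OF assms(1)])
  then show ?case using assms(2)[of a] by (simp add: Re_exp)
next
  case (sin a)
  have "Im (fourier f a) = (LINT x|lborel. Im (complex_of_real (f x) * plane_wave a x))"
    unfolding fourier_def by (rule integral_Im[symmetric]) (rule integrable_mult_plane_wave[OF assms(1)])
  then show ?case using assms(2)[of a] by (simp add: Im_exp)
next
  case (add g h)
  then show ?case
    by (simp add: distrib_left integrable_mult_trig_poly[OF assms(1)])
next
  case (cmult g c)
  have "(\<lambda>x. f x * (c * g x)) = (\<lambda>x. c * (f x * g x))" by (simp add: mult_ac)
  then show ?case using cmult by simp
qed

text \<open>With vanishing transform, f is orthogonal to all trigonometric polynomials.
  Approximating f by such a g uniformly on a ball that contains the support, the integral of f^2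
  equals that of f (f - g) and is arbitrarily small.\<close>

lemma fourier_eq_0_imp:
  assumes "test_function f" "AE k in lborel. fourier f k = 0"
  shows "f x = 0"
proof -
  note int = test_function_integrable[OF assms(1)]
  have z: "fourier f k = 0" for k
    by (rule AE_zero_continuous_imp_zero[OF continuous_on_fourier[OF int] assms(2)])
  obtain B where B: "B > 0" "\<And>x. norm x > B \<Longrightarrow> f x = 0"
    using test_function_bounded_support[OF assms(1)] by blast
  obtain M where M: "M > 0" "\<And>x. \<bar>f x\<bar> \<le> M" using test_function_bounded[OF assms(1)] by blast
  have [measurable]: "f \<in> borel_measurable borel" by (rule test_function_measurable[OF assms(1)])
  interpret function_ring_on trig_poly "cball 0 B"
  proof
    show "(\<lambda>_. c) \<in> trig_poly" for c
      using trig_poly.cmult[OF trig_poly.cos[of 0], of c] by simp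
    fix x y :: space assume "x \<noteq> y"
    \<comment> \<open>Scaled so that the phases at x and y differ by exactly 1. If cosine and sine
      both agreed there, the cosine of the difference would be 1, but cos 1 is not.\<close>
    define a where "a = (x - y) /\<^sub>R (norm (x - y))\<^sup>2"
    have "a \<bullet> x - a \<bullet> y = 1"
      using \<open>x \<noteq> y\<close> unfolding a_def inner_diff_right[symmetric]
      by (simp add: power2_norm_eq_inner)
    moreover have "cos (1::real) \<noteq> 1"
      using cos_monotone_0_pi[of 0 1] pi_gt3 by simp
    ultimately have "cos (a \<bullet> x) \<noteq> cos (a \<bullet> y) \<or> sin (a \<bullet> x) \<noteq> sin (a \<bullet> y)"
      using cos_diff[of "a \<bullet> x" "a \<bullet> y"] sin_cos_squared_add3[of "a \<bullet> x"] by auto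
    then show "\<exists>g\<in>trig_poly. g x \<noteq> g y"
      using bexI[OF _ trig_poly.cos[of a], of "\<lambda>g. g x \<noteq> g y"]
        bexI[OF _ trig_poly.sin[of a], of "\<lambda>g. g x \<noteq> g y"] by blast
  qed (auto intro: trig_poly.add trig_poly_mult trig_poly_continuous)
  have int2: "integrable lborel (\<lambda>x. f x * f x)"
  proof (rule integrable_compact_support)
    show "norm (f x * f x) \<le> M * M" for x
      using mult_mono[OF M(2)[of x] M(2)[of x]] M(1) by (simp add: abs_mult)
  qed (use B in auto)
  define I where "I = (LINT x|lborel. \<bar>f x\<bar>)"
  have I0: "I \<ge> 0" by (simp add: I_def)
  have small: "(LINT x|lborel. f x * f x) \<le> e" if "e > 0" for e
  proof -
    \<comment> \<open>Uniform error d costs d I in the integral; I + 1 avoids dividing by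
      zero.\<close>
    define d where "d = e / (I + 1)"
    have d: "d > 0" using that I0 by (simp add: d_def)
    obtain g where g: "g \<in> trig_poly" "\<And>x. x \<in> cball 0 B \<Longrightarrow> \<bar>f x - g x\<bar> < d"
      using Stone_Weierstrass_basic[of f d] d continuous_on_subset[OF test_function_continuous[OF assms(1)]] by blast
    have "(LINT x|lborel. f x * f x) = (LINT x|lborel. f x * f x - f x * g x)"
      using integral_mult_trig_poly_eq_0[OF int z g(1)] int2 integrable_mult_trig_poly[OF int g(1)] by simp
    also have "\<dots> \<le> (LINT x|lborel. d * \<bar>f x\<bar>)"
    proof (rule integral_mono)
      fix x
      have "\<bar>f x\<bar> * \<bar>f x - g x\<bar> \<le> \<bar>f x\<bar> * d"
        using g(2)[of x] B(2)[of x] by (cases "norm x \<le> B") (auto intro!: mult_left_mono)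
      moreover have "f x * f x - f x * g x \<le> \<bar>f x\<bar> * \<bar>f x - g x\<bar>"
        by (metis abs_ge_self abs_mult right_diff_distrib)
      ultimately show "f x * f x - f x * g x \<le> d * \<bar>f x\<bar>" by (simp add: mult.commute)
    next
      show "integrable lborel (\<lambda>x. f x * f x - f x * g x)"
        by (intro Bochner_Integration.integrable_diff int2 integrable_mult_trig_poly[OF int g(1)])
      show "integrable lborel (\<lambda>x. d * \<bar>f x\<bar>)"
        by (intro integrable_mult_right integrable_abs int)
    qed
    also have "\<dots> = e * (I / (I + 1))" by (simp add: I_def d_def)
    also have "\<dots> \<le> e * 1" using that I0 by (intro mult_left_mono) auto
    finally show ?thesis by simp
  qed
  have "(LINT x|lborel. f x * f x) \<le> 0"
    by (rule field_le_epsilon) (simp only: add_0 small)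
  moreover have "(LINT x|lborel. f x * f x) \<ge> 0" by (rule Bochner_Integration.integral_nonneg) simp
  ultimately have "(LINT x|lborel. f x * f x) = 0" by simp
  then have "AE x in lborel. f x * f x = 0"
    using integral_nonneg_eq_0_iff_AE[OF int2] by simp
  then have "AE x in lborel. f x = 0" by simp
  then show ?thesis by (rule AE_zero_continuous_imp_zero[OF test_function_continuous[OF assms(1)]])
qed

section \<open>Gram determinants in a weighted space\<close>

lemma borel_measurable_cnj [measurable]:
  "f \<in> borel_measurable M \<Longrightarrow> (\<lambda>x. cnj (f x)) \<in> borel_measurable M"
  by (rule measurable_compose[of f M borel cnj])
     (auto intro: borel_measurable_continuous_onI continuous_intros)

text \<open>The majorant glues a Beta integrand with parameters 1 - a and 1, integrable at the
  origin because a < 1, to the tail 1/t^2, and adds the mirror image for negative t.\<close>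

lemma integrable_powr_line:
  assumes "0 < a" "a < 1"
  shows "integrable lborel (\<lambda>t::real. \<bar>t\<bar> powr (-a) / (1 + \<bar>t\<bar>)\<^sup>2)"
proof -
  define f1 where "f1 = (\<lambda>t::real. indicator {0..1} t *\<^sub>R (t powr ((1 - a) - 1) * (1 - t) powr (1 - 1)))"
  define f2 where "f2 = (\<lambda>t::real. indicator {1..} t *\<^sub>R (1 / t\<^sup>2))"
  have i1: "integrable lborel f1"
    using integrable_Beta[of "1 - a" 1] assms
    unfolding set_integrable_def f1_def by simp
  have "(\<integral>\<^sup>+t. ennreal (1 / t\<^sup>2) * indicator {1..} t \<partial>lborel) = ennreal (0 - (- 1 / 1))"
  proof (rule nn_integral_FTC_atLeast[where F = "\<lambda>t. - 1 / t"])
    show "((\<lambda>t::real. - 1 / t) has_real_derivative 1 / t\<^sup>2) (at t)" if "1 \<le> t" for t :: real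
      using that by (auto intro!: derivative_eq_intros simp: power2_eq_square)
    show "((\<lambda>t::real. - 1 / t) \<longlongrightarrow> 0) at_top"
      by (rule real_tendsto_divide_at_top[OF tendsto_const filterlim_ident])
  qed auto
  moreover have "ennreal (norm (f2 t)) = ennreal (1 / t\<^sup>2) * indicator {1..} t" for t
    by (auto simp: f2_def indicator_def)
  ultimately have "(\<integral>\<^sup>+t. ennreal (norm (f2 t)) \<partial>lborel) < \<infinity>" by simp
  then have i2: "integrable lborel f2"
    by (intro integrableI_bounded) (auto simp: f2_def)
  have f: "integrable lborel (\<lambda>t. f1 t + f2 t)" using i1 i2 by simp
  have "integrable lborel (\<lambda>t. f1 (- t) + f2 (- t))"
    using lborel_integrable_real_affine[OF f, of "-1" 0] by simp
  with f have "integrable lborel (\<lambda>t. (f1 t + f2 t) + (f1 (- t) + f2 (- t)))"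
    by (rule Bochner_Integration.integrable_add)
  then show ?thesis
  proof (rule Bochner_Integration.integrable_bound)
    have pos: "\<bar>t\<bar> powr (-a) / (1 + \<bar>t\<bar>)\<^sup>2 \<le> f1 t + f2 t" if "t > 0" for t :: real
    proof (cases "t < 1")
      case True
      have "t powr (-a) / (1 + t)\<^sup>2 \<le> t powr (-a) / 1"
        using that by (intro divide_left_mono one_le_power) auto
      then show ?thesis using that True by (simp add: f1_def f2_def)
    next
      case False
      have "t powr (-a) \<le> 1" using False assms powr_mono[of "-a" 0 t] by simp
      moreover have "1 / (1 + t)\<^sup>2 \<le> 1 / t\<^sup>2"
        using that by (intro divide_left_mono power_mono) auto
      ultimately have "t powr (-a) * (1 / (1 + t)\<^sup>2) \<le> 1 * (1 / t\<^sup>2)"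
        by (intro mult_mono) auto
      moreover have "f1 t \<ge> 0" by (simp add: f1_def)
      ultimately show ?thesis using that False by (simp add: f2_def)
    qed
    have nn: "f1 t + f2 t \<ge> 0" for t by (simp add: f1_def f2_def)
    show "AE t in lborel. norm (\<bar>t\<bar> powr (-a) / (1 + \<bar>t\<bar>)\<^sup>2)
        \<le> norm ((f1 t + f2 t) + (f1 (- t) + f2 (- t)))"
    proof (intro AE_I2)
      fix t :: real
      have le: "\<bar>t\<bar> powr (-a) / (1 + \<bar>t\<bar>)\<^sup>2 \<le> (f1 t + f2 t) + (f1 (- t) + f2 (- t))"
        using pos[of t] pos[of "-t"] nn[of t] nn[of "-t"] by (cases t "0::real" rule: linorder_cases) auto
      then show "norm (\<bar>t\<bar> powr (-a) / (1 + \<bar>t\<bar>)\<^sup>2)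
        \<le> norm ((f1 t + f2 t) + (f1 (- t) + f2 (- t)))" by simp
    qed
  qed measurable
qed

lemma AE_lborel_inner_neq_0:
  fixes b :: "'a::euclidean_space"
  assumes "b \<noteq> 0"
  shows "AE x in lborel. x \<bullet> b \<noteq> 0"
proof -
  have "{x. b \<bullet> x = 0} \<in> null_sets lebesgue"
    using negligible_hyperplane[of b 0] assms by (simp add: negligible_iff_null_sets)
  then have "{x. b \<bullet> x = 0} \<in> null_sets lborel"
    by (subst (asm) null_sets_completion_iff) (auto intro: borel_closed closed_hyperplane)
  then show ?thesis by (rule AE_I') (auto simp: inner_commute)
qed

text \<open>Since \<open>\<bar>x\<bar>\<close> dominates each coordinate, the radial weight is at most a product of
  one-dimensional weights.\<close>

lemma integrable_powr_norm:
  assumes "0 < a" "a < 1"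
  shows "integrable lborel (\<lambda>x::'a::euclidean_space. (norm x powr (-a) / (1 + norm x)\<^sup>2) ^ DIM('a))"
proof -
  define h where "h = (\<lambda>t::real. \<bar>t\<bar> powr (-a) / (1 + \<bar>t\<bar>)\<^sup>2)"
  have [measurable]: "h \<in> borel_measurable borel" unfolding h_def by measurable
  have h0: "h t \<ge> 0" for t by (simp add: h_def)
  have "integrable lborel h" using integrable_powr_line[OF assms] by (simp add: h_def)
  then have fin: "(\<integral>\<^sup>+t. ennreal (h t) \<partial>lborel) < \<infinity>"
    using h0 by (simp add: integrable_iff_bounded)
  have "(\<integral>\<^sup>+x. (\<Prod>b\<in>Basis. ennreal (h (x \<bullet> b))) \<partial>(lborel :: 'a measure))
      = (\<Prod>b\<in>(Basis :: 'a set). (\<integral>\<^sup>+t. ennreal (h t) \<partial>lborel))"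
    by (rule nn_integral_lborel_prod) auto
  also have "\<dots> < \<infinity>" using fin by (simp add: power_less_top_ennreal)
  finally have "integrable lborel (\<lambda>x::'a. \<Prod>b\<in>Basis. h (x \<bullet> b))"
    by (intro integrableI_bounded) (auto simp: prod_ennreal h0 abs_prod)
  then show ?thesis
  proof (rule Bochner_Integration.integrable_bound)
    \<comment> \<open>The coordinate hyperplanes are discarded because \<open>0 powr (- a)\<close>
      is 0 there, which would break the comparison.\<close>
    have "AE x in lborel. \<forall>b\<in>Basis. (x::'a) \<bullet> b \<noteq> 0"
      by (rule AE_finite_allI) (auto intro: AE_lborel_inner_neq_0)
    then show "AE x in lborel. norm ((norm (x::'a) powr (-a) / (1 + norm x)\<^sup>2) ^ DIM('a))
        \<le> norm (\<Prod>b\<in>Basis. h (x \<bullet> b))"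
    proof eventually_elim
      case (elim x)
      have "(norm x powr (-a) / (1 + norm x)\<^sup>2) ^ DIM('a)
          = (\<Prod>b\<in>(Basis::'a set). norm x powr (-a) / (1 + norm x)\<^sup>2)" by simp
      also have "\<dots> \<le> (\<Prod>b\<in>(Basis::'a set). h (x \<bullet> b))"
      proof (rule prod_mono, rule conjI)
        fix b :: 'a assume b: "b \<in> Basis"
        have le: "\<bar>x \<bullet> b\<bar> \<le> norm x" using Basis_le_norm[OF b] .
        have p: "\<bar>x \<bullet> b\<bar> > 0" using elim b by simp
        have "norm x powr (-a) \<le> \<bar>x \<bullet> b\<bar> powr (-a)"
          using le p assms by (intro powr_mono2') auto
        then show "norm x powr (-a) / (1 + norm x)\<^sup>2 \<le> h (x \<bullet> b)"
          unfolding h_def using le p by (intro frac_le power_mono) auto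
      qed simp
      finally show ?case by (simp add: abs_prod h0)
    qed
  qed measurable
qed

text \<open>One square-integrable weight plays the part of an L2 space: functions bounded by
  multiples of it have integrable products, and \<theta>^2 serves as the majorant for dominated
  convergence.\<close>

locale L2_weight =
  fixes M :: "'a measure" and \<theta> :: "'a \<Rightarrow> real"
  assumes weight_measurable [measurable]: "\<theta> \<in> borel_measurable M"
    and weight_nonneg: "\<And>x. \<theta> x \<ge> 0"
    and weight_square_integrable: "integrable M (\<lambda>x. (\<theta> x)\<^sup>2)"
begin

definition dominated :: "('a \<Rightarrow> complex) \<Rightarrow> bool" where
  "dominated f \<longleftrightarrow> f \<in> borel_measurable M \<and> (\<exists>C. \<forall>x. norm (f x) \<le> C * \<theta> x)"

text \<open>The real part makes this a real inner product, matching the symmetrized two-point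
  function; independence below is therefore over the reals.\<close>

definition ip :: "('a \<Rightarrow> complex) \<Rightarrow> ('a \<Rightarrow> complex) \<Rightarrow> real" where
  "ip f g = Re (LINT x|M. f x * cnj (g x))"

definition gram :: "('a \<Rightarrow> complex) \<Rightarrow> ('a \<Rightarrow> complex) \<Rightarrow> real" where
  "gram f g = ip f f * ip g g - (ip f g)\<^sup>2"

lemma integrable_of_bound:
  assumes "f \<in> borel_measurable M" "g \<in> borel_measurable M"
    "\<And>x. norm (f x) \<le> C * \<theta> x" "\<And>x. norm (g x) \<le> D * \<theta> x"
  shows "integrable M (\<lambda>x. f x * cnj (g x))" "\<And>x. norm (f x * cnj (g x)) \<le> C * D * (\<theta> x)\<^sup>2"
proof -
  show b: "norm (f x * cnj (g x)) \<le> C * D * (\<theta> x)\<^sup>2" for x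
    using mult_mono[OF assms(3)[of x] assms(4)[of x]] order_trans[OF norm_ge_zero assms(3)[of x]]
    by (simp add: norm_mult power2_eq_square mult_ac)
  show "integrable M (\<lambda>x. f x * cnj (g x))"
  proof (rule Bochner_Integration.integrable_bound)
    show "integrable M (\<lambda>x. C * D * (\<theta> x)\<^sup>2)"
      using weight_square_integrable by simp
    show "(\<lambda>x. f x * cnj (g x)) \<in> borel_measurable M" using assms(1,2) by measurable
    show "AE x in M. norm (f x * cnj (g x)) \<le> norm (C * D * (\<theta> x)\<^sup>2)"
      by (intro AE_I2) (metis b abs_ge_self order_trans real_norm_def)
  qed
qed

lemma integrable_dominated:
  assumes "dominated f" "dominated g"
  shows "integrable M (\<lambda>x. f x * cnj (g x))"
  using assms integrable_of_bound(1) unfolding dominated_def by blast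

lemma dominated_lincomb:
  assumes "dominated f" "dominated g"
  shows "dominated (\<lambda>x. complex_of_real a * f x + complex_of_real b * g x)"
proof -
  obtain C D where C: "\<And>x. norm (f x) \<le> C * \<theta> x" and D: "\<And>x. norm (g x) \<le> D * \<theta> x"
    and [measurable]: "f \<in> borel_measurable M" "g \<in> borel_measurable M"
    using assms unfolding dominated_def by blast
  have "norm (complex_of_real a * f x + complex_of_real b * g x) \<le> (\<bar>a\<bar> * C + \<bar>b\<bar> * D) * \<theta> x" for x
  proof -
    have "norm (complex_of_real a * f x + complex_of_real b * g x) \<le> \<bar>a\<bar> * norm (f x) + \<bar>b\<bar> * norm (g x)"
      by (rule norm_triangle_le) (simp add: norm_mult)
    also have "\<dots> \<le> \<bar>a\<bar> * (C * \<theta> x) + \<bar>b\<bar> * (D * \<theta> x)"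
      by (intro add_mono mult_left_mono C D) auto
    finally show ?thesis by (simp add: algebra_simps)
  qed
  then show ?thesis unfolding dominated_def by (intro conjI exI allI) auto
qed

lemma ip_eq:
  assumes "dominated f" "dominated g"
  shows "ip f g = (LINT x|M. Re (f x * cnj (g x)))"
  unfolding ip_def by (rule integral_Re[symmetric]) (rule integrable_dominated[OF assms])

lemma ip_commute:
  assumes "dominated f" "dominated g"
  shows "ip f g = ip g f"
  by (simp add: ip_eq assms mult.commute)

lemma ip_lincomb_left:
  assumes "dominated f" "dominated g" "dominated h"
  shows "ip (\<lambda>x. complex_of_real a * f x + complex_of_real b * g x) h = a * ip f h + b * ip g h"
  unfolding ip_def
  using integrable_dominated[OF assms(1,3)] integrable_dominated[OF assms(2,3)]
  by (simp add: ring_distribs mult.assoc)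

lemma ip_lincomb_right:
  assumes "dominated f" "dominated g" "dominated h"
  shows "ip h (\<lambda>x. complex_of_real a * f x + complex_of_real b * g x) = a * ip h f + b * ip h g"
  by (simp add: ip_commute[of h] assms dominated_lincomb ip_lincomb_left)

lemma gram_lincomb:
  assumes "dominated f" "dominated g"
  shows "gram (\<lambda>x. complex_of_real a * f x + complex_of_real b * g x)
     (\<lambda>x. complex_of_real c * f x + complex_of_real d * g x) = (a * d - b * c)\<^sup>2 * gram f g"
  by (simp add: gram_def ip_lincomb_left ip_lincomb_right dominated_lincomb assms ip_commute[of g f])
     (simp add: power2_eq_square algebra_simps)

lemma ip_nonneg:
  assumes "dominated f"
  shows "ip f f \<ge> 0"
  by (simp add: ip_eq assms Bochner_Integration.integral_nonneg)

lemma ip_eq_0_imp: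
  assumes "dominated f" "ip f f = 0"
  shows "AE x in M. f x = 0"
proof -
  have "integrable M (\<lambda>x. Re (f x * cnj (f x)))"
    by (rule integrable_Re) (rule integrable_dominated[OF assms(1,1)])
  then have "AE x in M. Re (f x * cnj (f x)) = 0"
    using assms(2) by (subst (asm) ip_eq[OF assms(1,1)]) (simp add: integral_nonneg_eq_0_iff_AE)
  then show ?thesis
    by eventually_elim (simp add: complex_eq_iff sum_squares_eq_zero_iff)
qed

lemma gram_pos:
  assumes "dominated f" "dominated g"
    and indep: "\<And>a b. AE x in M. complex_of_real a * f x + complex_of_real b * g x = 0 \<Longrightarrow> a = 0 \<and> b = 0"
  shows "gram f g > 0"
proof -
  have "ip g g \<noteq> 0"
    using ip_eq_0_imp[OF assms(2)] indep[of 0 1] by auto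
  then have g: "ip g g > 0" using ip_nonneg[OF assms(2)] by simp
  \<comment> \<open>The coefficient that makes f + t g orthogonal to g. The Gram determinant is then
    the product of the squared norms of g and of this remainder.\<close>
  define t where "t = - ip f g / ip g g"
  define w where "w = (\<lambda>x. complex_of_real 1 * f x + complex_of_real t * g x)"
  have w: "dominated w" unfolding w_def by (rule dominated_lincomb[OF assms(1,2)])
  have "ip w w \<noteq> 0"
    using ip_eq_0_imp[OF w] indep[of 1 t] unfolding w_def by auto
  then have "ip w w > 0" using ip_nonneg[OF w] by simp
  moreover have "ip w w = ip f f + 2 * t * ip f g + t\<^sup>2 * ip g g"
    unfolding w_def
    by (simp only: ip_lincomb_left ip_lincomb_right dominated_lincomb assms ip_commute[of g f])
       (simp add: power2_eq_square algebra_simps)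
  moreover have "ip g g * (ip f f + 2 * t * ip f g + t\<^sup>2 * ip g g) = gram f g"
    using g by (simp add: t_def gram_def field_simps power2_eq_square)
  ultimately show ?thesis using g by (metis mult_pos_pos)
qed

text \<open>The hypotheses of dominated convergence, with one constant for all L from 1 on.\<close>

definition converges :: "(real \<Rightarrow> 'a \<Rightarrow> complex) \<Rightarrow> ('a \<Rightarrow> complex) \<Rightarrow> bool" where
  "converges f l \<longleftrightarrow> (\<forall>L\<ge>1. f L \<in> borel_measurable M) \<and> l \<in> borel_measurable M \<and>
     (\<exists>C. (\<forall>L\<ge>1. \<forall>x. norm (f L x) \<le> C * \<theta> x)) \<and> (\<forall>x. ((\<lambda>L. f L x) \<longlongrightarrow> l x) at_top)"

lemma converges_dominated: "converges f l \<Longrightarrow> L \<ge> 1 \<Longrightarrow> dominated (f L)"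
  unfolding converges_def dominated_def by blast

lemma converges_lim_dominated:
  assumes "converges f l"
  shows "dominated l"
proof -
  obtain C where C: "\<And>L x. L \<ge> 1 \<Longrightarrow> norm (f L x) \<le> C * \<theta> x"
    using assms unfolding converges_def by blast
  have "norm (l x) \<le> C * \<theta> x" for x
  proof (rule tendsto_upperbound)
    show "((\<lambda>L. norm (f L x)) \<longlongrightarrow> norm (l x)) at_top"
      using assms unfolding converges_def by (intro tendsto_norm) blast
    show "\<forall>\<^sub>F L in at_top. norm (f L x) \<le> C * \<theta> x"
      using C by (auto simp: eventually_at_top_linorder)
  qed simp
  then show ?thesis using assms unfolding dominated_def converges_def by blast
qed

lemma converges_add:
  assumes "converges f l" "converges g m"
  shows "converges (\<lambda>L x. f L x + g L x) (\<lambda>x. l x + m x)"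
proof -
  obtain C where C: "\<And>L x. L \<ge> 1 \<Longrightarrow> norm (f L x) \<le> C * \<theta> x"
    using assms unfolding converges_def by blast
  obtain D where D: "\<And>L x. L \<ge> 1 \<Longrightarrow> norm (g L x) \<le> D * \<theta> x"
    using assms unfolding converges_def by blast
  have "norm (f L x + g L x) \<le> (C + D) * \<theta> x" if "L \<ge> 1" for L x
    using norm_triangle_le[OF add_mono[OF C[OF that] D[OF that]]] by (simp add: ring_distribs)
  then have "\<exists>C. \<forall>L\<ge>1. \<forall>x. norm (f L x + g L x) \<le> C * \<theta> x" by blast
  then show ?thesis
    using assms unfolding converges_def by (auto intro!: tendsto_add borel_measurable_add)
qed

lemma converges_cmult:
  assumes "converges f l" "(c \<longlongrightarrow> c') at_top" "\<And>L. L \<ge> 1 \<Longrightarrow> \<bar>c L\<bar> \<le> B"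
  shows "converges (\<lambda>L x. complex_of_real (c L) * f L x) (\<lambda>x. complex_of_real c' * l x)"
proof -
  obtain C where C: "\<And>L x. L \<ge> 1 \<Longrightarrow> norm (f L x) \<le> C * \<theta> x"
    using assms unfolding converges_def by blast
  have "norm (complex_of_real (c L) * f L x) \<le> (B * C) * \<theta> x" if "L \<ge> 1" for L x
    using mult_mono[OF assms(3)[OF that] C[OF that, of x]] order_trans[OF abs_ge_zero assms(3)[OF that]]
    by (simp add: norm_mult mult.assoc)
  then have "\<exists>C. \<forall>L\<ge>1. \<forall>x. norm (complex_of_real (c L) * f L x) \<le> C * \<theta> x" by blast
  then show ?thesis
    using assms(1) unfolding converges_def by (auto intro!: tendsto_intros assms(2))
qed

lemma converges_const_mult:
  assumes "converges f l"
  shows "converges (\<lambda>L x. complex_of_real c * f L x) (\<lambda>x. complex_of_real c * l x)"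
  by (rule converges_cmult[OF assms tendsto_const, of _ "\<bar>c\<bar>"]) simp

lemma tendsto_ip:
  assumes "converges f l" "converges g m"
  shows "((\<lambda>L. ip (f L) (g L)) \<longlongrightarrow> ip l m) at_top"
proof -
  obtain C where C: "\<And>L x. L \<ge> 1 \<Longrightarrow> norm (f L x) \<le> C * \<theta> x"
    using assms unfolding converges_def by blast
  obtain D where D: "\<And>L x. L \<ge> 1 \<Longrightarrow> norm (g L x) \<le> D * \<theta> x"
    using assms unfolding converges_def by blast
  have [measurable]: "l \<in> borel_measurable M" "m \<in> borel_measurable M"
    and ms: "\<And>L. L \<ge> 1 \<Longrightarrow> f L \<in> borel_measurable M" "\<And>L. L \<ge> 1 \<Longrightarrow> g L \<in> borel_measurable M"
    using assms unfolding converges_def by auto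
  \<comment> \<open>Measurability and bounds are known only for L at least 1; freezing smaller L at
    1 provides them for every L without changing the limit.\<close>
  define f' where "f' = (\<lambda>L. f (max 1 L))"
  define g' where "g' = (\<lambda>L. g (max 1 L))"
  have [measurable]: "f' L \<in> borel_measurable M" "g' L \<in> borel_measurable M" for L
    using ms by (auto simp: f'_def g'_def)
  have ev: "\<forall>\<^sub>F L in at_top. f' L = f L \<and> g' L = g L"
    by (rule eventually_mono[OF eventually_ge_at_top[of 1]]) (auto simp: f'_def g'_def max_def)
  have "((\<lambda>L. LINT x|M. f' L x * cnj (g' L x)) \<longlongrightarrow> (LINT x|M. l x * cnj (m x))) at_top"
  proof (rule integral_dominated_convergence_at_top)
    show "integrable M (\<lambda>x. C * D * (\<theta> x)\<^sup>2)" using weight_square_integrable by simp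
    show "\<forall>\<^sub>F L in at_top. AE x in M. norm (f' L x * cnj (g' L x)) \<le> C * D * (\<theta> x)\<^sup>2"
      by (intro always_eventually allI AE_I2 integrable_of_bound(2)) (auto simp: f'_def g'_def ms C D)
    show "AE x in M. ((\<lambda>L. f' L x * cnj (g' L x)) \<longlongrightarrow> l x * cnj (m x)) at_top"
    proof (intro AE_I2)
      fix x
      have "((\<lambda>L. f L x * cnj (g L x)) \<longlongrightarrow> l x * cnj (m x)) at_top"
        using assms unfolding converges_def by (auto intro!: tendsto_intros)
      then show "((\<lambda>L. f' L x * cnj (g' L x)) \<longlongrightarrow> l x * cnj (m x)) at_top"
        by (rule Lim_transform_eventually) (use ev in \<open>eventually_elim, auto\<close>)
    qed
  qed measurable
  then have "((\<lambda>L. ip (f' L) (g' L)) \<longlongrightarrow> ip l m) at_top"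
    unfolding ip_def by (rule tendsto_Re)
  then show ?thesis
    by (rule Lim_transform_eventually) (use ev in \<open>eventually_elim, auto\<close>)
qed

lemma tendsto_gram:
  assumes "converges f l" "converges g m"
  shows "((\<lambda>L. gram (f L) (g L)) \<longlongrightarrow> gram l m) at_top"
  unfolding gram_def by (intro tendsto_intros tendsto_ip assms)

end

section \<open>Change of size as a change of state\<close>

definition scale_modes :: "real \<Rightarrow> modes \<Rightarrow> modes" where
  "scale_modes R s = ((\<lambda>k. fst s (k / R) / complex_of_real (sqrt R)),
                      (\<lambda>k. complex_of_real (sqrt R) * snd s (k / R)))"

lemma integral_lborel_scale:
  fixes f :: "space \<Rightarrow> complex"
  assumes "f \<in> borel_measurable borel" "c > 0"
  shows "(LINT x|lborel. f x) = complex_of_real (c ^ 3) * (LINT x|lborel. f (c *\<^sub>R x))"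
proof -
  have "(lborel :: space measure) = density (distr lborel borel (\<lambda>x. 0 + c *\<^sub>R x)) (\<lambda>_. ennreal (\<bar>c\<bar> ^ DIM(space)))"
    using lborel_affine[of c "0 :: space"] assms(2) by simp
  then have e: "(lborel :: space measure) = density (distr lborel borel (\<lambda>x. c *\<^sub>R x)) (\<lambda>_. ennreal (c ^ 3))"
    using assms(2) by simp
  have "(LINT x|lborel. f x) = (LINT x|distr lborel borel (\<lambda>x. c *\<^sub>R x). c ^ 3 *\<^sub>R f x)"
    by (subst e, rule integral_density) (use assms in auto)
  also have "\<dots> = (LINT x|lborel. c ^ 3 *\<^sub>R f (c *\<^sub>R x))"
    by (rule integral_distr) (use assms in auto)
  also have "\<dots> = c ^ 3 *\<^sub>R (LINT x|lborel. f (c *\<^sub>R x))" by simp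
  finally show ?thesis by (simp add: scaleR_conv_of_real)
qed

lemma fourier_scale:
  assumes "f \<in> borel_measurable borel" "R > 0"
  shows "fourier (\<lambda>x. f (x /\<^sub>R R)) k = complex_of_real (R ^ 3) * fourier f (R *\<^sub>R k)"
proof -
  have "(\<lambda>x. complex_of_real (f (x /\<^sub>R R)) * plane_wave k x) \<in> borel_measurable borel"
    using assms(1) by measurable
  from integral_lborel_scale[OF this assms(2)] show ?thesis
    using assms(2) by (simp add: fourier_def)
qed

text \<open>The Jacobian R^3 against the prefactors of the smearing functions leaves R for the field
  profile and R^2 for the momentum profile. Their geometric mean is pulled out, and the square roots
  of R that remain are those in \<open>scale_modes\<close>.\<close>

lemma mode_amplitude_scale:
  assumes "test_function (fst \<gamma>)" "test_function (snd \<gamma>)" "R > 0"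
  shows "mode_amplitude s (scale_smearing R \<gamma>) (k /\<^sub>R R)
    = complex_of_real (R * sqrt R) * mode_amplitude (scale_modes R s) \<gamma> k"
proof -
  have m: "fst \<gamma> \<in> borel_measurable borel" "snd \<gamma> \<in> borel_measurable borel"
    using assms by (auto intro: test_function_measurable)
  have 1: "fourier (\<lambda>x. f x / c) q = fourier f q / complex_of_real c" for f q and c :: real
    unfolding fourier_def by simp
  have f: "fourier (fst (scale_smearing R \<gamma>)) (k /\<^sub>R R) = complex_of_real (R\<^sup>2) * fourier (fst \<gamma>) k"
    "fourier (snd (scale_smearing R \<gamma>)) (k /\<^sub>R R) = complex_of_real R * fourier (snd \<gamma>) k"
    using assms(3) by (simp_all add: scale_smearing_def 1 fourier_scale[OF m(1)] fourier_scale[OF m(2)]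
        power2_eq_square power3_eq_cube)
  have s: "complex_of_real R = complex_of_real (sqrt R) * complex_of_real (sqrt R)"
    using assms(3) by (simp flip: of_real_mult)
  have s0: "complex_of_real (sqrt R) \<noteq> 0" using assms(3) by simp
  have n: "norm (k /\<^sub>R R) = norm k / R" using assms(3) by (simp add: divide_inverse mult.commute)
  show ?thesis
    unfolding mode_amplitude_def f n
    unfolding scale_modes_def of_real_mult of_real_power s
    using s0 by (simp add: field_simps power2_eq_square)
qed

definition measurable_modes :: "modes \<Rightarrow> bool" where
  "measurable_modes s \<longleftrightarrow> fst s \<in> borel_measurable borel \<and> snd s \<in> borel_measurable borel"

lemma mode_amplitude_measurable:
  assumes "measurable_modes s" "test_function (fst \<gamma>)" "test_function (snd \<gamma>)"
  shows "mode_amplitude s \<gamma> \<in> borel_measurable borel"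
proof -
  have [measurable]: "fourier (fst \<gamma>) \<in> borel_measurable borel" "fourier (snd \<gamma>) \<in> borel_measurable borel"
    using assms by (auto intro: fourier_measurable test_function_integrable)
  have [measurable]: "fst s \<in> borel_measurable borel" "snd s \<in> borel_measurable borel"
    using assms(1) by (auto simp: measurable_modes_def)
  show ?thesis unfolding mode_amplitude_def by measurable
qed

text \<open>The two extracted factors R^(3/2) multiply to R^3, which cancels the Jacobian of the
  momentum substitution.\<close>

lemma anticommutator_vev_scale:
  assumes "measurable_modes s" "test_function (fst \<gamma>)" "test_function (snd \<gamma>)"
    "test_function (fst \<gamma>')" "test_function (snd \<gamma>')" "R > 0"
  shows "anticommutator_vev s (scale_smearing R \<gamma>) (scale_smearing R \<gamma>')
    = anticommutator_vev (scale_modes R s) \<gamma> \<gamma>'"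
proof -
  define Z where "Z = (\<lambda>k. mode_amplitude s (scale_smearing R \<gamma>) k
    * cnj (mode_amplitude s (scale_smearing R \<gamma>') k) / complex_of_real ((2 * pi) ^ 3))"
  define Y where "Y = (\<lambda>k. mode_amplitude (scale_modes R s) \<gamma> k
    * cnj (mode_amplitude (scale_modes R s) \<gamma>' k) / complex_of_real ((2 * pi) ^ 3))"
  have Z: "Z (k /\<^sub>R R) = complex_of_real (R ^ 3) * Y k" for k
  proof -
    have "complex_of_real (R * sqrt R) * complex_of_real (R * sqrt R) = complex_of_real (R ^ 3)"
      using assms(6) unfolding of_real_mult[symmetric] by (simp add: power3_eq_cube mult_ac)
    then show ?thesis
      unfolding Z_def Y_def using assms by (simp add: mode_amplitude_scale) (metis mult.assoc mult.left_commute)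
  qed
  have "measurable_modes (scale_modes R s)"
    using assms(1) unfolding measurable_modes_def scale_modes_def by auto
  then have [measurable]: "mode_amplitude (scale_modes R s) \<gamma> \<in> borel_measurable borel"
    "mode_amplitude (scale_modes R s) \<gamma>' \<in> borel_measurable borel"
    using assms by (auto intro: mode_amplitude_measurable)
  have "Z k = complex_of_real (R ^ 3) * Y (R *\<^sub>R k)" for k
    using Z[of "R *\<^sub>R k"] assms(6) by simp
  then have Z': "Z = (\<lambda>k. complex_of_real (R ^ 3) * Y (R *\<^sub>R k))" by blast
  have "Y \<in> borel_measurable borel" unfolding Y_def by (intro borel_measurable_divide borel_measurable_times borel_measurable_cnj) auto
  from integral_lborel_scale[OF this assms(6)] have "(LINT k|lborel. Z k) = (LINT k|lborel. Y k)"
    unfolding Z' by simp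
  then show ?thesis unfolding anticommutator_vev_def Z_def Y_def by simp
qed

lemma mode_entropy_scale:
  assumes "measurable_modes s" "single_mode \<Gamma>" "R > 0"
  shows "mode_entropy s (scale_mode R \<Gamma>) = mode_entropy (scale_modes R s) \<Gamma>"
proof -
  have "covariance s (scale_mode R \<Gamma>) = covariance (scale_modes R s) \<Gamma>"
    using assms unfolding covariance_def scale_mode_def single_mode_def
    by (simp add: anticommutator_vev_scale)
  then show ?thesis by (simp add: mode_entropy_def symplectic_eigenvalue_def)
qed

text \<open>Raising the argument of the second logarithm to that of the first leaves exactly one
  logarithm as a lower bound. Divergence is the property required, since the Minkowski value is a
  fixed number.\<close>

lemma filterlim_entropy_fn: "filterlim entropy_fn at_top at_top"
proof (rule filterlim_at_top_mono)
  show "filterlim (\<lambda>\<nu>::real. log 2 ((\<nu> + 1) / 2)) at_top at_top"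
    unfolding log_def by real_asymp
  have "log 2 ((\<nu> + 1) / 2) \<le> entropy_fn \<nu>" if "\<nu> \<ge> 2" for \<nu> :: real
  proof -
    have "(\<nu> - 1) / 2 * log 2 ((\<nu> - 1) / 2) \<le> (\<nu> - 1) / 2 * log 2 ((\<nu> + 1) / 2)"
      using that by (intro mult_left_mono) auto
    then show ?thesis unfolding entropy_fn_def by (simp add: field_simps)
  qed
  then show "\<forall>\<^sub>F \<nu> in at_top. log 2 ((\<nu> + 1) / 2) \<le> entropy_fn \<nu>"
    by (auto simp: eventually_at_top_linorder)
qed

text \<open>The massless mode functions are homogeneous of degree -1/2 and 1/2 in k, which the
  square roots of R compensate.\<close>

lemma scale_modes_minkowski:
  assumes "R > 0"
  shows "mode_entropy (scale_modes R minkowski) \<Gamma> = mode_entropy minkowski \<Gamma>"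
proof -
  have "mode_amplitude (scale_modes R minkowski) \<gamma> k = mode_amplitude minkowski \<gamma> k" for \<gamma> k
  proof -
    have "fst (scale_modes R minkowski) x = fst minkowski x" "snd (scale_modes R minkowski) x = snd minkowski x" for x
      using assms unfolding scale_modes_def minkowski_def
      by (simp_all add: real_sqrt_divide real_sqrt_mult)
    then show ?thesis unfolding mode_amplitude_def by simp
  qed
  then have "mode_amplitude (scale_modes R minkowski) = mode_amplitude minkowski" by (intro ext)
  then show ?thesis
    by (simp add: mode_entropy_def symplectic_eigenvalue_def covariance_def anticommutator_vev_def)
qed

lemma measurable_modes_minkowski: "measurable_modes minkowski"
  unfolding measurable_modes_def minkowski_def by simp

section \<open>Large-scale limit of the Bunch-Davies amplitudes\<close>

context L2_weight begin

text \<open>The Gram determinant of u and v is that of f and g times the squared coefficient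
  determinant. The former has a positive limit, so growth is decided by the coefficients
  alone.\<close>

lemma filterlim_gram_at_top:
  assumes "converges f l" "converges g m"
    and indep: "\<And>a b. AE x in M. complex_of_real a * l x + complex_of_real b * m x = 0 \<Longrightarrow> a = 0 \<and> b = 0"
    and u: "\<And>L x. L \<ge> 1 \<Longrightarrow> u L x = complex_of_real (a L) * f L x + complex_of_real (b L) * g L x"
    and v: "\<And>L x. L \<ge> 1 \<Longrightarrow> v L x = complex_of_real (c L) * f L x + complex_of_real (d L) * g L x"
    and det: "filterlim (\<lambda>L. (a L * d L - b L * c L)\<^sup>2) at_top at_top"
  shows "filterlim (\<lambda>L. gram (u L) (v L)) at_top at_top"
proof -
  have "gram l m > 0"
    by (rule gram_pos[OF assms(1,2)[THEN converges_lim_dominated] indep])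
  from filterlim_tendsto_pos_mult_at_top[OF tendsto_gram[OF assms(1,2)] this det]
  have "filterlim (\<lambda>L. gram (f L) (g L) * (a L * d L - b L * c L)\<^sup>2) at_top at_top" .
  moreover have "\<forall>\<^sub>F L in at_top. gram (f L) (g L) * (a L * d L - b L * c L)\<^sup>2 = gram (u L) (v L)"
    using eventually_ge_at_top[of 1]
  proof eventually_elim
    case (elim L)
    have "u L = (\<lambda>x. complex_of_real (a L) * f L x + complex_of_real (b L) * g L x)"
      "v L = (\<lambda>x. complex_of_real (c L) * f L x + complex_of_real (d L) * g L x)"
      using u[OF elim] v[OF elim] by auto
    then show ?case
      using gram_lincomb[OF converges_dominated[OF assms(1) elim] converges_dominated[OF assms(2) elim]]
      by (simp add: mult.commute)
  qed
  ultimately show ?thesis using filterlim_cong[OF refl refl] by fastforce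
qed

end

section \<open>A common majorant and the limits of the rescaled mode functions\<close>

definition mode_weight :: "real \<Rightarrow> space \<Rightarrow> real" where
  "mode_weight n k = norm k powr (- n) / (1 + norm k) ^ 3"

text \<open>The square of the weight is the cube of the one-dimensional weight with a = 2n/3, and n
  < 3/2 is the condition a < 1.\<close>

lemma L2_weight_mode_weight:
  assumes "0 < n" "n < 3/2"
  shows "L2_weight lborel (mode_weight n)"
proof
  show "mode_weight n \<in> borel_measurable lborel" unfolding mode_weight_def by measurable
  show "0 \<le> mode_weight n k" for k by (simp add: mode_weight_def)
  have "(mode_weight n k)\<^sup>2 = (norm k powr (- (2 * n / 3)) / (1 + norm k)\<^sup>2) ^ DIM(space)" for k
  proof -
    have "(norm k powr (- n))\<^sup>2 = norm k powr (- (2 * n))"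
      by (cases "k = 0") (simp_all flip: powr_numeral add: powr_powr mult.commute)
    moreover have "(norm k powr (- (2 * n / 3))) ^ 3 = norm k powr (- (2 * n))"
      by (cases "k = 0") (simp_all flip: powr_numeral add: powr_powr)
    ultimately show ?thesis
      by (simp add: mode_weight_def power_divide power_mult[symmetric])
  qed
  then show "integrable lborel (\<lambda>k. (mode_weight n k)\<^sup>2)"
    using integrable_powr_norm[of "2 * n / 3", where 'a = space] assms by simp
qed

text \<open>The power of L cancels the growth (p/L)^(-\<nu>) at small argument, so that a finite
  limit exists.\<close>

definition hankel1_scaled :: "real \<Rightarrow> real \<Rightarrow> real \<Rightarrow> complex" where
  "hankel1_scaled \<nu> L p = complex_of_real (L powr (- \<nu>)) * hankel1 \<nu> (p / L)"

text \<open>By the reflection formula this is 2^\<nu> Gamma(\<nu>) / pi at non-integer \<nu>, the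
  usual coefficient; the form here is what the quotient defining Y yields.\<close>

definition hankel1_leading :: "real \<Rightarrow> real" where
  "hankel1_leading \<nu> = 2 powr \<nu> * rGamma (1 - \<nu>) / sin (\<nu> * pi)"

lemma hankel1_leading_neq_0:
  assumes "\<nu> \<notin> \<int>"
  shows "hankel1_leading \<nu> \<noteq> 0"
proof -
  have "1 - \<nu> \<notin> \<int>" using assms Ints_diff[OF Ints_1, of "1 - \<nu>"] by auto
  then have "1 - \<nu> \<notin> \<int>\<^sub>\<le>\<^sub>0" using nonpos_Ints_subset_Ints by blast
  moreover have "sin (\<nu> * pi) \<noteq> 0"
    using assms by (metis Ints_of_int mult_cancel_right pi_neq_zero sin_zero_iff_int2)
  ultimately show ?thesis by (simp add: hankel1_leading_def rGamma_eq_zero_iff)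
qed

lemma hankel1_scaled_tendsto:
  assumes "\<nu> > 0" "\<nu> \<notin> \<int>" "p \<ge> 0"
  shows "((\<lambda>L. hankel1_scaled \<nu> L p) \<longlongrightarrow> - \<i> * complex_of_real (hankel1_leading \<nu> * p powr (- \<nu>))) at_top"
proof (cases "p = 0")
  case True
  then show ?thesis using hankel1_0[OF assms(2)] by (simp add: hankel1_scaled_def)
next
  case False
  then have p: "p > 0" using assms by simp
  have "filterlim (\<lambda>L. p / L) (at_right 0) at_top" using p by real_asymp
  from filterlim_compose[OF tendsto_hankel1[OF assms(1,2)] this]
  have "((\<lambda>L. complex_of_real (p powr (- \<nu>)) * (complex_of_real ((p / L) powr \<nu>) * hankel1 \<nu> (p / L))) \<longlongrightarrow>
      complex_of_real (p powr (- \<nu>)) * (- \<i> * complex_of_real (hankel1_leading \<nu>))) at_top"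
    unfolding hankel1_leading_def by (rule tendsto_mult[OF tendsto_const])
  moreover have "\<forall>\<^sub>F L in at_top. complex_of_real (p powr (- \<nu>)) * (complex_of_real ((p / L) powr \<nu>) * hankel1 \<nu> (p / L))
      = hankel1_scaled \<nu> L p"
    using eventually_gt_at_top[of 0]
  proof eventually_elim
    case (elim L)
    have "p powr (- \<nu>) * (p / L) powr \<nu> = L powr (- \<nu>)"
      using p elim by (simp add: powr_divide powr_minus field_simps)
    then show ?case unfolding hankel1_scaled_def by (metis mult.assoc of_real_mult)
  qed
  ultimately have "((\<lambda>L. hankel1_scaled \<nu> L p) \<longlongrightarrow>
      complex_of_real (p powr (- \<nu>)) * (- \<i> * complex_of_real (hankel1_leading \<nu>))) at_top"
    by (rule Lim_transform_eventually)
  then show ?thesis by (simp add: mult_ac)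
qed

text \<open>The singular term is invariant under the rescaling, and the term p^2 only shrinks when L
  is at least 1; hence the uniformity in L.\<close>

lemma hankel1_scaled_bound:
  assumes "0 < \<nu>" "\<nu> \<le> 2" "\<nu> \<notin> \<int>"
  shows "\<exists>C\<ge>0. \<forall>L\<ge>1. \<forall>p\<ge>0. norm (hankel1_scaled \<nu> L p) \<le> C * (p powr (- \<nu>) + p\<^sup>2)"
proof -
  obtain C where C: "C \<ge> 0" "\<And>x. x \<ge> 0 \<Longrightarrow> norm (hankel1 \<nu> x) \<le> C * (x powr (- \<nu>) + x\<^sup>2)"
    using hankel1_bound[OF assms] by blast
  have "norm (hankel1_scaled \<nu> L p) \<le> C * (p powr (- \<nu>) + p\<^sup>2)" if L: "L \<ge> 1" and p: "p \<ge> 0" for L p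
  proof -
    have "norm (hankel1_scaled \<nu> L p) \<le> L powr (- \<nu>) * (C * ((p / L) powr (- \<nu>) + (p / L)\<^sup>2))"
      unfolding hankel1_scaled_def norm_mult using C(2)[of "p / L"] L p
      by (simp add: mult_left_mono)
    also have "\<dots> = C * (L powr (- \<nu>) * (p / L) powr (- \<nu>) + L powr (- \<nu>) * (p / L)\<^sup>2)"
      by (simp add: algebra_simps)
    also have "\<dots> \<le> C * (p powr (- \<nu>) + p\<^sup>2)"
    proof (intro mult_left_mono add_mono C)
      show "L powr (- \<nu>) * (p / L) powr (- \<nu>) \<le> p powr (- \<nu>)"
        using L p by (simp add: powr_divide)
      have "L powr (- \<nu>) \<le> 1" using L assms by (simp add: powr_minus divide_simps ge_one_powr_ge_zero)
      moreover have "(p / L)\<^sup>2 \<le> p\<^sup>2" using L p by (intro power_mono) (auto simp: divide_le_eq mult_le_cancel_left1)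
      ultimately have "L powr (- \<nu>) * (p / L)\<^sup>2 \<le> 1 * p\<^sup>2" by (intro mult_mono) auto
      then show "L powr (- \<nu>) * (p / L)\<^sup>2 \<le> p\<^sup>2" by simp
    qed
    finally show ?thesis .
  qed
  then show ?thesis using C(1) by blast
qed

lemma hankel1_scaled_measurable:
  assumes "\<nu> \<notin> \<int>"
  shows "hankel1_scaled \<nu> L \<in> borel_measurable borel"
proof -
  note [measurable] = borel_measurable_hankel1[OF assms]
  show ?thesis unfolding hankel1_scaled_def by measurable
qed

text \<open>The exponents e in use are 0 and n + 2 for the field part, 2 and n + 3 for the momentum
  part; all stay below 5 for n < 3/2.\<close>

lemma powr_weight_le:
  assumes "p \<ge> (0::real)" "0 \<le> e" "e \<le> 5"
  shows "p powr (e - n) \<le> p powr (- n) * (1 + p) ^ 5"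
proof (cases "p = 0")
  case False
  have "p powr e \<le> (1 + p) powr e" using assms by (intro powr_mono2) auto
  also have "\<dots> \<le> (1 + p) powr 5" using assms by (intro powr_mono) auto
  also have "\<dots> = (1 + p) ^ 5" using assms by (simp add: powr_numeral)
  finally have "p powr (- n) * p powr e \<le> p powr (- n) * (1 + p) ^ 5"
    by (rule mult_left_mono) simp
  then show ?thesis by (simp add: powr_add[symmetric])
qed simp

text \<open>Applied to both profiles: the term of \<pi>_k with \<open>mu_sq\<close> has the same
  dependence on k as \<phi>_k. The other term of \<pi>_k, of order n - 1, is
  \<open>momentum_part\<close>. Powers of L are kept outside.\<close>

definition field_part :: "real \<Rightarrow> (space \<Rightarrow> real) \<Rightarrow> real \<Rightarrow> space \<Rightarrow> complex" where
  "field_part n f L k = fourier f k * (complex_of_real (sqrt (pi / 4)) * hankel1_scaled n L (norm k))"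

definition momentum_part :: "real \<Rightarrow> (space \<Rightarrow> real) \<Rightarrow> real \<Rightarrow> space \<Rightarrow> complex" where
  "momentum_part n f L k =
     fourier f k * (complex_of_real (sqrt (pi / 4) * norm k) * hankel1_scaled (n - 1) L (norm k))"

definition field_limit :: "real \<Rightarrow> (space \<Rightarrow> real) \<Rightarrow> space \<Rightarrow> complex" where
  "field_limit n f k = fourier f k * (complex_of_real (sqrt (pi / 4)) *
     (- \<i> * complex_of_real (hankel1_leading n * norm k powr (- n))))"

definition momentum_limit :: "real \<Rightarrow> (space \<Rightarrow> real) \<Rightarrow> space \<Rightarrow> complex" where
  "momentum_limit n f k = fourier f k * (complex_of_real (sqrt (pi / 4) * norm k) *
     (- \<i> * complex_of_real (hankel1_leading (n - 1) * norm k powr (- (n - 1)))))"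

lemma field_part_lincomb:
  assumes "test_function f" "test_function g"
  shows "field_part n (\<lambda>x. a * f x + b * g x) L k
    = complex_of_real a * field_part n f L k + complex_of_real b * field_part n g L k"
  by (simp add: field_part_def fourier_lincomb test_function_integrable assms algebra_simps)

lemma momentum_part_lincomb:
  assumes "test_function f" "test_function g"
  shows "momentum_part n (\<lambda>x. a * f x + b * g x) L k
    = complex_of_real a * momentum_part n f L k + complex_of_real b * momentum_part n g L k"
  by (simp add: momentum_part_def fourier_lincomb test_function_integrable assms algebra_simps)

text \<open>Decay of order 8 is spent as 5 + 3: five powers absorb the growth of the mode function,
  three supply the decay of the weight.\<close>

lemma converges_fourier_mult:
  fixes \<phi> :: "real \<Rightarrow> real \<Rightarrow> complex"
  assumes n: "0 < n" "n < 3/2" and f: "test_function f"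
    and m: "\<And>L. \<phi> L \<in> borel_measurable borel" "\<phi>' \<in> borel_measurable borel"
    and b: "\<And>L p. L \<ge> 1 \<Longrightarrow> p \<ge> 0 \<Longrightarrow> norm (\<phi> L p) \<le> K * (p powr (- n) * (1 + p) ^ 5)"
    and l: "\<And>p. p \<ge> 0 \<Longrightarrow> ((\<lambda>L. \<phi> L p) \<longlongrightarrow> \<phi>' p) at_top"
  shows "L2_weight.converges lborel (mode_weight n) (\<lambda>L k. fourier f k * \<phi> L (norm k))
    (\<lambda>k. fourier f k * \<phi>' (norm k))"
proof -
  interpret L2_weight lborel "mode_weight n" by (rule L2_weight_mode_weight[OF n])
  note [measurable] = m fourier_measurable[OF test_function_integrable[OF f]]
  obtain C where C: "C \<ge> 0" "\<And>k. (1 + norm k) ^ 8 * norm (fourier f k) \<le> C"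
    using fourier_decay[OF f, of 8] by blast
  have "norm (fourier f k * \<phi> L (norm k)) \<le> (C * K) * mode_weight n k" if L: "L \<ge> 1" for L k
  proof -
    have pos: "(1 + norm k) ^ 8 > 0" "(1 + norm k) ^ 5 > 0" "(1 + norm k) ^ 3 > 0"
      by (intro zero_less_power; simp add: add_pos_nonneg)+
    have "norm (fourier f k) \<le> C / (1 + norm k) ^ 8"
      using C(2)[of k] pos by (simp add: pos_le_divide_eq mult.commute)
    then have "norm (fourier f k * \<phi> L (norm k))
        \<le> C / (1 + norm k) ^ 8 * (K * (norm k powr (- n) * (1 + norm k) ^ 5))"
      unfolding norm_mult using C(1) pos by (intro mult_mono b L) auto
    also have "(1 + norm k) ^ 8 = (1 + norm k) ^ 5 * (1 + norm k) ^ 3"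
      by (simp flip: power_add)
    also have "C / ((1 + norm k) ^ 5 * (1 + norm k) ^ 3) * (K * (norm k powr (- n) * (1 + norm k) ^ 5))
        = (C * K) * mode_weight n k"
      using pos unfolding mode_weight_def by (simp add: field_simps del: zero_less_power)
    finally show ?thesis .
  qed
  then have "\<exists>C. \<forall>L\<ge>1. \<forall>k. norm (fourier f k * \<phi> L (norm k)) \<le> C * mode_weight n k" by blast
  then show ?thesis
    unfolding converges_def by (auto intro!: tendsto_mult tendsto_const l)
qed

lemma order_not_Ints:
  fixes n :: real
  assumes "1 < n" "n < 3/2"
  shows "n \<notin> \<int>" "n - 1 \<notin> \<int>"
proof -
  show "n - 1 \<notin> \<int>"
  proof
    assume "n - 1 \<in> \<int>"
    then obtain j where j: "n - 1 = of_int j" by (auto simp: Ints_def)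
    then have "(0::real) < of_int j" "of_int j < (1::real)" using assms by linarith+
    then have "0 < j" "j < 1" by auto
    then show False by simp
  qed
  then show "n \<notin> \<int>" using Ints_diff[OF _ Ints_1, of n] by blast
qed

lemma converges_field_part:
  assumes n: "1 < n" "n < 3/2" and f: "test_function f"
  shows "L2_weight.converges lborel (mode_weight n) (field_part n f) (field_limit n f)"
proof -
  note nI = order_not_Ints[OF n]
  obtain C where C: "C \<ge> 0" "\<And>L p. L \<ge> 1 \<Longrightarrow> p \<ge> 0 \<Longrightarrow> norm (hankel1_scaled n L p) \<le> C * (p powr (- n) + p\<^sup>2)"
    using hankel1_scaled_bound[of n] n nI by force
  have [measurable]: "hankel1_scaled n L \<in> borel_measurable borel" for L
    using nI by (intro hankel1_scaled_measurable)
  have b: "norm (complex_of_real (sqrt (pi / 4)) * hankel1_scaled n L p)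
      \<le> (sqrt (pi / 4) * (2 * C)) * (p powr (- n) * (1 + p) ^ 5)" if "L \<ge> 1" "p \<ge> 0" for L p
  proof -
    have "p\<^sup>2 = p powr ((n + 2) - n)" using that by simp
    also have "\<dots> \<le> p powr (- n) * (1 + p) ^ 5" using that n by (intro powr_weight_le) auto
    finally have "p powr (- n) + p\<^sup>2 \<le> 2 * (p powr (- n) * (1 + p) ^ 5)"
      using powr_weight_le[of p 0 n] that by simp
    then have "C * (p powr (- n) + p\<^sup>2) \<le> C * (2 * (p powr (- n) * (1 + p) ^ 5))"
      by (rule mult_left_mono[OF _ C(1)])
    then have "norm (hankel1_scaled n L p) \<le> 2 * C * (p powr (- n) * (1 + p) ^ 5)"
      using C(2)[OF that] by (simp only: mult_ac)
    then have "sqrt (pi / 4) * norm (hankel1_scaled n L p) \<le> sqrt (pi / 4) * (2 * C * (p powr (- n) * (1 + p) ^ 5))"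
      by (rule mult_left_mono) simp
    then show ?thesis by (simp add: norm_mult mult.assoc)
  qed
  show ?thesis
    unfolding field_part_def[abs_def] field_limit_def[abs_def]
  proof (rule converges_fourier_mult[where K = "sqrt (pi / 4) * (2 * C)"
        and \<phi> = "\<lambda>L p. complex_of_real (sqrt (pi / 4)) * hankel1_scaled n L p"
        and \<phi>' = "\<lambda>p. complex_of_real (sqrt (pi / 4)) * (- \<i> * complex_of_real (hankel1_leading n * p powr (- n)))"])
    show "((\<lambda>L. complex_of_real (sqrt (pi / 4)) * hankel1_scaled n L p) \<longlongrightarrow>
        complex_of_real (sqrt (pi / 4)) * (- \<i> * complex_of_real (hankel1_leading n * p powr (- n)))) at_top"
      if "p \<ge> 0" for p
      using n that nI by (intro tendsto_mult tendsto_const hankel1_scaled_tendsto) auto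
    show "(\<lambda>p. complex_of_real (sqrt (pi / 4)) * hankel1_scaled n L p) \<in> borel_measurable borel" for L
      by measurable
    show "(\<lambda>p. complex_of_real (sqrt (pi / 4)) * (- \<i> * complex_of_real (hankel1_leading n * p powr (- n))))
        \<in> borel_measurable borel"
      by measurable
  qed (use n in \<open>auto intro: f b simp del: of_real_mult\<close>)
qed

text \<open>The extra factor p turns p^(1-n) into p^(2-n), milder at the origin than p^(-n), so the
  weight of the field part serves here as well.\<close>

lemma converges_momentum_part:
  assumes n: "1 < n" "n < 3/2" and f: "test_function f"
  shows "L2_weight.converges lborel (mode_weight n) (momentum_part n f) (momentum_limit n f)"
proof -
  note nI = order_not_Ints[OF n]
  obtain C where C: "C \<ge> 0" "\<And>L p. L \<ge> 1 \<Longrightarrow> p \<ge> 0 \<Longrightarrow> norm (hankel1_scaled (n - 1) L p) \<le> C * (p powr (- (n - 1)) + p\<^sup>2)"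
    using hankel1_scaled_bound[of "n - 1"] n nI by force
  have [measurable]: "hankel1_scaled (n - 1) L \<in> borel_measurable borel" for L
    using nI by (intro hankel1_scaled_measurable)
  have b: "norm (complex_of_real (sqrt (pi / 4) * p) * hankel1_scaled (n - 1) L p)
      \<le> (sqrt (pi / 4) * (2 * C)) * (p powr (- n) * (1 + p) ^ 5)" if "L \<ge> 1" "p \<ge> 0" for L p
  proof -
    have "p * p\<^sup>2 = p powr ((n + 3) - n)" using that by (simp add: power2_eq_square power3_eq_cube)
    also have "\<dots> \<le> p powr (- n) * (1 + p) ^ 5" using that n by (intro powr_weight_le) auto
    finally have 1: "p * p\<^sup>2 \<le> p powr (- n) * (1 + p) ^ 5" .
    have "p * p powr (- (n - 1)) = p powr (2 - n)"
      using that powr_add[of p 1 "1 - n"] by (cases "p = 0") simp_all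
    also have "\<dots> \<le> p powr (- n) * (1 + p) ^ 5" using that n by (intro powr_weight_le) auto
    finally have "p * (p powr (- (n - 1)) + p\<^sup>2) \<le> 2 * (p powr (- n) * (1 + p) ^ 5)"
      using 1 by (simp add: distrib_left)
    then have "C * (p * (p powr (- (n - 1)) + p\<^sup>2)) \<le> C * (2 * (p powr (- n) * (1 + p) ^ 5))"
      by (rule mult_left_mono[OF _ C(1)])
    then have "p * norm (hankel1_scaled (n - 1) L p) \<le> 2 * C * (p powr (- n) * (1 + p) ^ 5)"
      using mult_left_mono[OF C(2)[OF that] that(2)] by (simp only: mult_ac)
    then have "sqrt (pi / 4) * (p * norm (hankel1_scaled (n - 1) L p)) \<le> sqrt (pi / 4) * (2 * C * (p powr (- n) * (1 + p) ^ 5))"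
      by (rule mult_left_mono) simp
    then show ?thesis using that by (simp add: norm_mult mult.assoc)
  qed
  show ?thesis
    unfolding momentum_part_def[abs_def] momentum_limit_def[abs_def]
  proof (rule converges_fourier_mult[where K = "sqrt (pi / 4) * (2 * C)"
        and \<phi> = "\<lambda>L p. complex_of_real (sqrt (pi / 4) * p) * hankel1_scaled (n - 1) L p"
        and \<phi>' = "\<lambda>p. complex_of_real (sqrt (pi / 4) * p) * (- \<i> * complex_of_real (hankel1_leading (n - 1) * p powr (- (n - 1))))"])
    show "((\<lambda>L. complex_of_real (sqrt (pi / 4) * p) * hankel1_scaled (n - 1) L p) \<longlongrightarrow>
        complex_of_real (sqrt (pi / 4) * p) * (- \<i> * complex_of_real (hankel1_leading (n - 1) * p powr (- (n - 1))))) at_top"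
      if "p \<ge> 0" for p
      using n that nI by (intro tendsto_mult tendsto_const hankel1_scaled_tendsto) auto
    show "(\<lambda>p. complex_of_real (sqrt (pi / 4) * p) * hankel1_scaled (n - 1) L p) \<in> borel_measurable borel" for L
      by measurable
    show "(\<lambda>p. complex_of_real (sqrt (pi / 4) * p) * (- \<i> * complex_of_real (hankel1_leading (n - 1) * p powr (- (n - 1)))))
        \<in> borel_measurable borel"
      by measurable
  qed (use n in \<open>auto intro: f b simp del: of_real_mult\<close>)
qed

section \<open>Linear independence of the limits\<close>

lemma AE_norm_notin_finite:
  assumes "finite S"
  shows "AE k in (lborel :: space measure). norm k \<notin> S"
proof -
  have "AE k in (lborel :: space measure). \<forall>r\<in>S. norm k \<noteq> r"
  proof (rule AE_finite_allI[OF assms])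
    fix r
    have "sphere (0::space) r \<in> null_sets lebesgue"
      using negligible_sphere[of "0::space" r] by (simp add: negligible_iff_null_sets)
    then have "sphere (0::space) r \<in> null_sets lborel"
      by (subst (asm) null_sets_completion_iff) (auto intro: borel_closed)
    then show "AE k in (lborel :: space measure). norm k \<noteq> r"
      by (rule AE_I') (auto simp: dist_norm)
  qed
  then show ?thesis by eventually_elim blast
qed

text \<open>Spheres are null sets, so a multiplier that vanishes on finitely many of them can be
  divided out before injectivity is applied.\<close>

lemma fourier_mult_eq_0_imp:
  assumes "test_function f" "finite S" "AE k in lborel. fourier f k * \<phi> k = 0"
    and "\<And>k. norm k \<notin> S \<Longrightarrow> \<phi> k \<noteq> 0"
  shows "f x = 0"
proof (rule fourier_eq_0_imp[OF assms(1)])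
  show "AE k in lborel. fourier f k = 0"
    using assms(3) AE_norm_notin_finite[OF assms(2)] by eventually_elim (use assms(4) in auto)
qed

lemma field_limits_independent:
  assumes n: "1 < n" "n < 3/2" and "test_function f" "test_function g"
    and indep: "\<And>a b. (\<And>x. a * f x + b * g x = 0) \<Longrightarrow> a = 0 \<and> b = 0"
    and ae: "AE k in lborel. complex_of_real a * field_limit n f k + complex_of_real b * field_limit n g k = 0"
  shows "a = 0 \<and> b = 0"
proof (rule indep)
  fix x
  let ?\<phi> = "\<lambda>k::space. complex_of_real (sqrt (pi / 4)) * (- \<i> * complex_of_real (hankel1_leading n * norm k powr (- n)))"
  show "a * f x + b * g x = 0"
  proof (rule fourier_mult_eq_0_imp[where S = "{0}" and \<phi> = ?\<phi>])
    show "test_function (\<lambda>x. a * f x + b * g x)" by (rule test_function_lincomb[OF assms(3,4)])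
    have "complex_of_real a * field_limit n f k + complex_of_real b * field_limit n g k
        = fourier (\<lambda>x. a * f x + b * g x) k * ?\<phi> k" for k
      by (simp add: fourier_lincomb test_function_integrable assms(3,4) field_limit_def algebra_simps)
    then show "AE k in lborel. fourier (\<lambda>x. a * f x + b * g x) k * ?\<phi> k = 0"
      using ae by simp
    show "?\<phi> k \<noteq> 0" if "norm k \<notin> {0}" for k
      using that hankel1_leading_neq_0[OF order_not_Ints(1)[OF n]] by simp
  qed simp
qed

text \<open>Both limits carry the same transform, and their combination is |k|^(-n) times a
  polynomial in |k|^2 of degree at most one, which has at most one zero unless a = b = 0.\<close>

lemma momentum_field_limits_independent:
  assumes n: "1 < n" "n < 3/2" and f: "test_function f" "f x0 \<noteq> 0"
    and ae: "AE k in lborel. complex_of_real a * momentum_limit n f k + complex_of_real b * field_limit n f k = 0"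
  shows "a = 0 \<and> b = 0"
proof (rule ccontr)
  assume ab: "\<not> (a = 0 \<and> b = 0)"
  define cw where "cw = hankel1_leading (n - 1)"
  define cu where "cu = hankel1_leading n"
  have c: "cw \<noteq> 0" "cu \<noteq> 0"
    using hankel1_leading_neq_0 order_not_Ints[OF n] by (auto simp: cw_def cu_def)
  define \<phi> where "\<phi> = (\<lambda>k::space. complex_of_real (sqrt (pi / 4)) * (- \<i>) *
      complex_of_real (norm k powr (- n) * (a * cw * (norm k)\<^sup>2 + b * cu)))"
  \<comment> \<open>The origin, where \<open>powr\<close> has its default value, and the only
    candidate for a root; for a = 0 the polynomial is a nonzero constant.\<close>
  define S where "S = (if a = 0 then {0} else {0, sqrt (- (b * cu) / (a * cw))})"
  have "f x0 = 0"
  proof (rule fourier_mult_eq_0_imp[where S = S and \<phi> = \<phi>])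
    show "finite S" by (simp add: S_def)
    have "complex_of_real a * momentum_limit n f k + complex_of_real b * field_limit n f k
        = fourier f k * \<phi> k" for k
    proof (cases "k = 0")
      case False
      have "norm k * norm k powr (- (n - 1)) = (norm k)\<^sup>2 * norm k powr (- n)"
        using False by (simp add: powr_diff powr_minus power2_eq_square field_simps)
      then have "complex_of_real (norm k) * complex_of_real (norm k powr (- (n - 1))) =
          complex_of_real ((norm k)\<^sup>2) * complex_of_real (norm k powr (- n))"
        unfolding of_real_mult[symmetric] by simp
      then show ?thesis
        unfolding momentum_limit_def field_limit_def \<phi>_def cw_def[symmetric] cu_def[symmetric] of_real_mult of_real_add
        by algebra
    qed (simp add: momentum_limit_def field_limit_def \<phi>_def)
    then show "AE k in lborel. fourier f k * \<phi> k = 0" using ae by simp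
    show "\<phi> k \<noteq> 0" if k: "norm k \<notin> S" for k
    proof -
      have k0: "norm k \<noteq> 0" using k by (auto simp: S_def split: if_splits)
      have "a * cw * (norm k)\<^sup>2 + b * cu \<noteq> 0"
      proof
        assume eq: "a * cw * (norm k)\<^sup>2 + b * cu = 0"
        show False
        proof (cases "a = 0")
          case True
          then show False using eq ab c by simp
        next
          case False
          then have "(norm k)\<^sup>2 = - (b * cu) / (a * cw)"
            using eq c by (simp add: field_simps)
          then have "norm k = sqrt (- (b * cu) / (a * cw))"
            by (metis norm_ge_zero real_sqrt_abs abs_of_nonneg)
          then show False using k False by (simp add: S_def)
        qed
      qed
      then have "norm k powr (- n) * (a * cw * (norm k)\<^sup>2 + b * cu) \<noteq> 0" using k0 by simp
      then have "complex_of_real (norm k powr (- n) * (a * cw * (norm k)\<^sup>2 + b * cu)) \<noteq> 0"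
        by (simp only: of_real_eq_0_iff not_False_eq_True)
      then show ?thesis unfolding \<phi>_def by (simp del: of_real_mult of_real_add)
    qed
  qed (rule f)
  with f show False by simp
qed

section \<open>The Bunch-Davies amplitude with its powers of L made explicit\<close>

definition amplitude_sum ::
  "real \<Rightarrow> (space \<Rightarrow> real) \<times> (space \<Rightarrow> real) \<Rightarrow> real \<Rightarrow> space \<Rightarrow> complex" where
  "amplitude_sum n \<gamma> L k = complex_of_real (L powr (n - 1/2)) *
     (field_part n (snd \<gamma>) L k + complex_of_real ((3/2 - n) * L) * field_part n (fst \<gamma>) L k
      + complex_of_real (1 / L) * momentum_part n (fst \<gamma>) L k)"

text \<open>With H = L, undoing the rescaling of the Hankel functions gives L^(n-1/2) for \<phi>_k,
  L^(n+1/2) for the \<open>mu_sq\<close> term of \<pi>_k and L^(n-3/2) for its other term. Here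
  \<open>mu_sq\<close> is 3/2 - n, and the two minus signs cancel.\<close>

lemma mode_amplitude_bunch_davies:
  assumes "\<rho> > 0" "L > 0" "n = sqrt (9/4 - \<rho>\<^sup>2)"
  shows "mode_amplitude (bunch_davies (\<rho> * L) L) \<gamma> k = amplitude_sum n \<gamma> L k"
proof -
  have mu: "mu_sq (\<rho> * L) L = 3/2 - n" and n: "bd_order (\<rho> * L) L = n"
    using assms by (simp_all add: mu_sq_def bd_order_def power_mult_distrib)
  have sL: "L powr (1/2) = sqrt L" using assms by (simp add: powr_half_sqrt)
  have sL2: "sqrt L * sqrt L = L" "sqrt L \<noteq> 0" using assms by auto
  \<comment> \<open>With the product u v equal to 1/sqrt L, all powers of L become rational
    expressions in u, v and L, and the identity is plain field arithmetic.\<close>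
  define u where "u = L powr (n - 1/2)"
  define v where "v = L powr (- n)"
  have "u * v = L powr (n - 1/2 + - n)" unfolding u_def v_def by (rule powr_add[symmetric])
  then have uv: "u * v = 1 / sqrt L" by (simp add: powr_minus sL inverse_eq_divide)
  have w: "L powr (- (n - 1)) = L * v"
    using assms by (simp add: v_def powr_diff powr_minus field_simps)
  define h0 where "h0 = hankel1 n (norm k / L)"
  define h1 where "h1 = hankel1 (n - 1) (norm k / L)"
  have q: "sqrt (pi / (4 * L)) = sqrt (pi / 4) * (u * v)" "sqrt (pi * L / 4) = sqrt (pi / 4) * (u * v) * L"
    using assms sL2 by (simp_all add: uv real_sqrt_divide real_sqrt_mult field_simps)
  have c: "complex_of_real L \<noteq> 0" using assms by simp
  show ?thesis
    unfolding mode_amplitude_def bunch_davies_def amplitude_sum_def field_part_def momentum_part_def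
      hankel1_scaled_def mu n fst_conv snd_conv q w
      h0_def[symmetric] h1_def[symmetric] u_def[symmetric] v_def[symmetric]
    using c by (simp add: field_simps)
qed

lemma measurable_modes_bunch_davies:
  assumes "1 < bd_order m H" "bd_order m H < 3/2"
  shows "measurable_modes (bunch_davies m H)"
proof -
  note [measurable] = borel_measurable_hankel1[OF order_not_Ints(1)[OF assms]]
    borel_measurable_hankel1[OF order_not_Ints(2)[OF assms]]
  show ?thesis unfolding measurable_modes_def bunch_davies_def by (simp; intro conjI; measurable)
qed

text \<open>The order depends only on m/H and the argument is k/H, so rescaling k amounts to
  multiplying m and H by the same R.\<close>

lemma scale_modes_bunch_davies:
  assumes "R > 0" "H > 0"
  shows "scale_modes R (bunch_davies m H) = bunch_davies (m * R) (H * R)"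
proof -
  have o: "mu_sq (m * R) (H * R) = mu_sq m H" "bd_order (m * R) (H * R) = bd_order m H"
    using assms by (simp_all add: mu_sq_def bd_order_def power_mult_distrib)
  have "sqrt (pi / (4 * (H * R))) = sqrt (pi / (4 * H)) / sqrt R"
    "sqrt (pi * (H * R) / 4) = sqrt R * sqrt (pi * H / 4)"
    using assms by (simp_all add: real_sqrt_mult real_sqrt_divide)
  then show ?thesis
    unfolding scale_modes_def bunch_davies_def o
    by (simp add: divide_divide_eq_left mult.commute[of R H] algebra_simps)
qed

lemma amplitude_sum_lincomb:
  assumes "test_function (fst \<gamma>)" "test_function (snd \<gamma>)" "test_function (fst \<gamma>')" "test_function (snd \<gamma>')"
  shows "amplitude_sum n (\<lambda>x. a * fst \<gamma> x + b * fst \<gamma>' x, \<lambda>x. a * snd \<gamma> x + b * snd \<gamma>' x) L k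
    = complex_of_real a * amplitude_sum n \<gamma> L k + complex_of_real b * amplitude_sum n \<gamma>' L k"
  unfolding amplitude_sum_def
  by (simp add: field_part_lincomb momentum_part_lincomb assms algebra_simps)

lemma tendsto_inverse_at_top: "((\<lambda>L::real. 1 / L) \<longlongrightarrow> 0) at_top"
  by real_asymp

section \<open>Growth of the Gram determinant at a fixed order between 1 and 3/2\<close>

locale squeezing =
  fixes n :: real
  assumes n: "1 < n" "n < 3/2"
begin

sublocale L2_weight lborel "mode_weight n"
  using n by (intro L2_weight_mode_weight) auto

lemmas field_converges = converges_field_part[OF n]
lemmas momentum_converges = converges_momentum_part[OF n]

lemma converges_add_decaying:
  assumes "converges f l" "converges g m"
  shows "converges (\<lambda>L x. f L x + complex_of_real (c / L) * g L x) l"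
proof -
  have "converges (\<lambda>L x. complex_of_real (c / L) * g L x) (\<lambda>x. complex_of_real 0 * m x)"
  proof (rule converges_cmult[OF assms(2)])
    show "((\<lambda>L. c / L) \<longlongrightarrow> 0) at_top" by real_asymp
    show "\<bar>c / L\<bar> \<le> \<bar>c\<bar>" if "L \<ge> 1" for L
      using that by (simp add: divide_le_eq mult_le_cancel_left1)
  qed
  from converges_add[OF assms(1) this] show ?thesis by simp
qed

lemma powr_square_at_top:
  fixes f :: "real \<Rightarrow> real"
  assumes "e > 0" "\<And>L. L \<ge> 1 \<Longrightarrow> f L = L powr e"
  shows "filterlim (\<lambda>L. (f L)\<^sup>2) at_top at_top"
proof -
  have "filterlim (\<lambda>L::real. L powr e) at_top at_top" using assms(1) by real_asymp
  moreover have "\<forall>\<^sub>F L in at_top. L powr e = f L"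
    using eventually_ge_at_top[of 1] by eventually_elim (simp add: assms(2))
  ultimately have "filterlim f at_top at_top" using filterlim_cong[OF refl refl] by fastforce
  then show ?thesis by (intro filterlim_pow_at_top) auto
qed

lemma powr_products:
  assumes "L \<ge> 1"
  shows "L powr (n - 1/2) * L powr (n - 1/2) = L powr (2 * n - 1)"
    "L powr (2 * n - 1) * L = L powr (2 * n)" "L powr (2 * n - 1) * (L * L) = L powr (2 * n + 1)"
    "L powr (2 * n - 1) / L = L powr (2 * n - 2)"
proof -
  have e: "n - 1/2 + (n - 1/2) = 2 * n - 1" "2 * n = (2 * n - 1) + 1" "2 * n + 1 = (2 * n - 1) + 2"
    "2 * n - 2 = (2 * n - 1) - 1" by simp_all
  show "L powr (n - 1/2) * L powr (n - 1/2) = L powr (2 * n - 1)"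
    by (simp only: powr_add[symmetric] e(1))
  show "L powr (2 * n - 1) * L = L powr (2 * n)"
    by (subst (2) e(2), subst powr_add) (use assms in simp)
  show "L powr (2 * n - 1) * (L * L) = L powr (2 * n + 1)"
    by (subst e(3), subst powr_add) (use assms in \<open>simp add: power2_eq_square\<close>)
  show "L powr (2 * n - 1) / L = L powr (2 * n - 2)"
    by (subst e(4), subst powr_diff) (use assms in simp)
qed

text \<open>The amplitude divided by L^(n+1/2), so that only the \<open>mu_sq\<close> term with the
  G profile survives in the limit.\<close>

definition normalized_amplitude ::
  "(space \<Rightarrow> real) \<times> (space \<Rightarrow> real) \<Rightarrow> real \<Rightarrow> space \<Rightarrow> complex" where
  "normalized_amplitude \<gamma> L k = complex_of_real (3/2 - n) * field_part n (fst \<gamma>) L k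
     + complex_of_real (1 / L) * field_part n (snd \<gamma>) L k
     + complex_of_real (1 / L) * (complex_of_real (1 / L) * momentum_part n (fst \<gamma>) L k)"

lemma amplitude_sum_normalized:
  assumes "L \<ge> 1"
  shows "amplitude_sum n \<gamma> L k = complex_of_real (L powr (n - 1/2) * L) * normalized_amplitude \<gamma> L k"
  using assms unfolding amplitude_sum_def normalized_amplitude_def by (simp add: field_simps)

lemma converges_normalized_amplitude:
  assumes "test_function (fst \<gamma>)" "test_function (snd \<gamma>)"
  shows "converges (normalized_amplitude \<gamma>)
    (\<lambda>k. complex_of_real (3/2 - n) * field_limit n (fst \<gamma>) k)"
proof -
  have "converges (\<lambda>L k. complex_of_real (1 / L) * momentum_part n (fst \<gamma>) L k) (\<lambda>k. complex_of_real 0 * momentum_limit n (fst \<gamma>) k)"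
    by (rule converges_cmult[OF momentum_converges[OF assms(1)] tendsto_inverse_at_top, of 1])
       (simp add: divide_le_eq)
  then show ?thesis
    unfolding normalized_amplitude_def[abs_def]
    by (rule converges_add_decaying[OF converges_add_decaying[OF
          converges_const_mult[OF field_converges[OF assms(1)]] field_converges[OF assms(2)]]])
qed

lemma field_limits_independent':
  assumes "test_function f" "test_function g" "p \<noteq> 0" "q \<noteq> 0"
    and indep: "\<And>a b. (\<And>x. a * f x + b * g x = 0) \<Longrightarrow> a = 0 \<and> b = 0"
    and ae: "AE k in lborel. complex_of_real a * (complex_of_real p * field_limit n f k)
      + complex_of_real b * (complex_of_real q * field_limit n g k) = 0"
  shows "a = 0 \<and> b = 0"
proof -
  have "a * p = 0 \<and> b * q = 0"
    by (rule field_limits_independent[OF n assms(1,2) indep]) (use ae in \<open>simp_all add: mult.assoc\<close>)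
  then show ?thesis using assms(3,4) by simp
qed

text \<open>The generic case: the normalized limits inherit the independence of the two G profiles,
  and two scale factors L^(n+1/2) give the coefficient determinant L^(2n+1).\<close>

lemma gram_at_top_independent:
  assumes t: "test_function (fst \<gamma>)" "test_function (snd \<gamma>)" "test_function (fst \<gamma>')" "test_function (snd \<gamma>')"
    and indep: "\<And>a b. (\<And>x. a * fst \<gamma> x + b * fst \<gamma>' x = 0) \<Longrightarrow> a = 0 \<and> b = 0"
  shows "filterlim (\<lambda>L. gram (amplitude_sum n \<gamma> L) (amplitude_sum n \<gamma>' L)) at_top at_top"
proof (rule filterlim_gram_at_top[OF converges_normalized_amplitude[OF t(1,2)] converges_normalized_amplitude[OF t(3,4)]])
  let ?s = "\<lambda>L. L powr (n - 1/2) * L"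
  show "amplitude_sum n \<gamma> L k = complex_of_real (?s L) * normalized_amplitude \<gamma> L k
      + complex_of_real 0 * normalized_amplitude \<gamma>' L k" if "L \<ge> 1" for L k
    using amplitude_sum_normalized[OF that] by simp
  show "amplitude_sum n \<gamma>' L k = complex_of_real 0 * normalized_amplitude \<gamma> L k
      + complex_of_real (?s L) * normalized_amplitude \<gamma>' L k" if "L \<ge> 1" for L k
    using amplitude_sum_normalized[OF that] by simp
  show "filterlim (\<lambda>L. (?s L * ?s L - 0 * 0)\<^sup>2) at_top at_top"
  proof (rule powr_square_at_top[of "2 * n + 1"])
    show "?s L * ?s L - 0 * 0 = L powr (2 * n + 1)" if "L \<ge> 1" for L
      using powr_products[OF that] by (simp add: mult_ac)
  qed (use n in simp)
  show "a = 0 \<and> b = 0" if "AE k in lborel. complex_of_real a * (complex_of_real (3/2 - n) * field_limit n (fst \<gamma>) k)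
      + complex_of_real b * (complex_of_real (3/2 - n) * field_limit n (fst \<gamma>') k) = 0" for a b
    by (rule field_limits_independent'[OF t(1,3) _ _ indep that]) (use n in auto)
qed

lemma amplitude_sum_pure_field:
  "amplitude_sum n ((\<lambda>x. 0), f) L k = complex_of_real (L powr (n - 1/2)) * field_part n f L k"
  by (simp add: amplitude_sum_def field_part_def momentum_part_def fourier_def)

text \<open>If one of the observables involves only the field, the leading powers of \<open>L\<close> may cancel;
  the worst case is that all profiles are proportional, where the Gram determinant
  still grows like \<open>L\<^bsup>4n-4\<^esup>\<close>.\<close>

lemma gram_at_top_pure_field:
  assumes t: "test_function (fst \<gamma>)" "test_function (snd \<gamma>)" "test_function f"
    and nz: "fst \<gamma> x0 \<noteq> 0" "f x0 \<noteq> 0"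
  shows "filterlim (\<lambda>L. gram (amplitude_sum n \<gamma> L) (amplitude_sum n ((\<lambda>x. 0), f) L)) at_top at_top"
proof (cases "\<forall>a b. (\<forall>x. a * fst \<gamma> x + b * f x = 0) \<longrightarrow> a = 0 \<and> b = 0")
  case True
  \<comment> \<open>G and f are independent: the scale factors L^(n+1/2) and L^(n-1/2) multiply to
    L^(2n).\<close>
  show ?thesis
  proof (rule filterlim_gram_at_top[OF converges_normalized_amplitude[OF t(1,2)] field_converges[OF t(3)]])
    let ?s = "\<lambda>L. L powr (n - 1/2)"
    show "amplitude_sum n \<gamma> L k = complex_of_real (?s L * L) * normalized_amplitude \<gamma> L k
        + complex_of_real 0 * field_part n f L k" if "L \<ge> 1" for L k
      using amplitude_sum_normalized[OF that] by simp
    show "amplitude_sum n ((\<lambda>x. 0), f) L k = complex_of_real 0 * normalized_amplitude \<gamma> L k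
        + complex_of_real (?s L) * field_part n f L k" if "L \<ge> 1" for L k
      by (simp add: amplitude_sum_pure_field)
    show "filterlim (\<lambda>L. (?s L * L * ?s L - 0 * 0)\<^sup>2) at_top at_top"
    proof (rule powr_square_at_top[of "2 * n"])
      show "?s L * L * ?s L - 0 * 0 = L powr (2 * n)" if "L \<ge> 1" for L
        using powr_products[OF that] by (simp add: mult_ac)
    qed (use n in simp)
    show "a = 0 \<and> b = 0" if "AE k in lborel. complex_of_real a * (complex_of_real (3/2 - n) * field_limit n (fst \<gamma>) k)
        + complex_of_real b * field_limit n f k = 0" for a b
    proof (rule field_limits_independent'[OF t(1,3)])
      show "AE k in lborel. complex_of_real a * (complex_of_real (3/2 - n) * field_limit n (fst \<gamma>) k)
        + complex_of_real b * (complex_of_real 1 * field_limit n f k) = 0"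
        using that by simp
      show "a' = 0 \<and> b' = 0" if "\<And>x. a' * fst \<gamma> x + b' * f x = 0" for a' b'
        using True that by blast
    qed (use n in auto)
  qed
next
  case False
  then obtain a b where ab: "\<And>x. a * fst \<gamma> x + b * f x = 0" "a \<noteq> 0 \<or> b \<noteq> 0" by blast
  then have a0: "a \<noteq> 0" using nz by force
  define c where "c = - b / a"
  have G: "fst \<gamma> = (\<lambda>x. c * f x + 0 * f x)"
    using ab(1) a0 by (auto simp: c_def field_simps eq_neg_iff_add_eq_0)
  then have c0: "c \<noteq> 0" using nz by auto
  have Gf: "field_part n (fst \<gamma>) L k = complex_of_real c * field_part n f L k" for L k
    by (subst G, subst field_part_lincomb[OF t(3) t(3)]) simp
  have Gm: "momentum_part n (fst \<gamma>) L k = complex_of_real c * momentum_part n f L k" for L k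
    by (subst G, subst momentum_part_lincomb[OF t(3) t(3)]) simp
  show ?thesis
  proof (cases "\<forall>a b. (\<forall>x. a * snd \<gamma> x + b * f x = 0) \<longrightarrow> a = 0 \<and> b = 0")
    case True
    \<comment> \<open>With G = c f, the part of order L of the first amplitude is a multiple of the
      second amplitude. It becomes an off-diagonal coefficient, which meets a zero in the
      determinant. Since F and f are independent, L^(2n-1) remains.\<close>
    show ?thesis
    proof (rule filterlim_gram_at_top[OF
          converges_add_decaying[OF field_converges[OF t(2)] momentum_converges[OF t(3)], of c]
          field_converges[OF t(3)]])
      let ?s = "\<lambda>L. L powr (n - 1/2)"
      show "amplitude_sum n \<gamma> L k = complex_of_real (?s L) *
            (field_part n (snd \<gamma>) L k + complex_of_real (c / L) * momentum_part n f L k)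
          + complex_of_real (?s L * ((3/2 - n) * L * c)) * field_part n f L k" if "L \<ge> 1" for L k
        unfolding amplitude_sum_def Gf Gm by (simp add: algebra_simps)
      show "amplitude_sum n ((\<lambda>x. 0), f) L k = complex_of_real 0 *
            (field_part n (snd \<gamma>) L k + complex_of_real (c / L) * momentum_part n f L k)
          + complex_of_real (?s L) * field_part n f L k" if "L \<ge> 1" for L k
        by (simp add: amplitude_sum_pure_field)
      show "filterlim (\<lambda>L. (?s L * ?s L - ?s L * ((3/2 - n) * L * c) * 0)\<^sup>2) at_top at_top"
      proof (rule powr_square_at_top[of "2 * n - 1"])
        show "?s L * ?s L - ?s L * ((3/2 - n) * L * c) * 0 = L powr (2 * n - 1)" if "L \<ge> 1" for L
          using powr_products[OF that] by simp
      qed (use n in simp)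
      show "a = 0 \<and> b = 0" if "AE k in lborel. complex_of_real a * field_limit n (snd \<gamma>) k
          + complex_of_real b * field_limit n f k = 0" for a b
      proof (rule field_limits_independent[OF n t(2,3) _ that])
        show "a' = 0 \<and> b' = 0" if "\<And>x. a' * snd \<gamma> x + b' * f x = 0" for a' b'
          using True that by blast
      qed
    qed
  next
    case False
    then obtain a b where ab: "\<And>x. a * snd \<gamma> x + b * f x = 0" "a \<noteq> 0 \<or> b \<noteq> 0" by blast
    then have a0: "a \<noteq> 0" using nz by force
    define d where "d = - b / a"
    have F: "snd \<gamma> = (\<lambda>x. d * f x + 0 * f x)"
      using ab(1) a0 by (auto simp: d_def field_simps eq_neg_iff_add_eq_0)
    have Ff: "field_part n (snd \<gamma>) L k = complex_of_real d * field_part n f L k" for L k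
      by (subst F, subst field_part_lincomb[OF t(3) t(3)]) simp
    \<comment> \<open>Now F and G are both multiples of f. Only the momentum part, with relative
      weight c/L and c nonzero, tells the amplitudes apart; the determinant is c L^(2n-2), which
      grows because n > 1.\<close>
    show ?thesis
    proof (rule filterlim_gram_at_top[OF momentum_converges[OF t(3)] field_converges[OF t(3)]])
      let ?s = "\<lambda>L. L powr (n - 1/2)"
      show "amplitude_sum n \<gamma> L k = complex_of_real (?s L * (c / L)) * momentum_part n f L k
          + complex_of_real (?s L * (d + (3/2 - n) * L * c)) * field_part n f L k" if "L \<ge> 1" for L k
        unfolding amplitude_sum_def Gf Gm Ff by (simp add: algebra_simps)
      show "amplitude_sum n ((\<lambda>x. 0), f) L k = complex_of_real 0 * momentum_part n f L k
          + complex_of_real (?s L) * field_part n f L k" if "L \<ge> 1" for L k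
        by (simp add: amplitude_sum_pure_field)
      have "filterlim (\<lambda>L. (?s L * (1 / L) * ?s L)\<^sup>2) at_top at_top"
      proof (rule powr_square_at_top[of "2 * n - 2"])
        show "?s L * (1 / L) * ?s L = L powr (2 * n - 2)" if "L \<ge> 1" for L
          using powr_products[OF that] by simp
      qed (use n in simp)
      then have "filterlim (\<lambda>L. c\<^sup>2 * (?s L * (1 / L) * ?s L)\<^sup>2) at_top at_top"
        using c0 by (intro filterlim_tendsto_pos_mult_at_top[OF tendsto_const]) auto
      then show "filterlim (\<lambda>L. (?s L * (c / L) * ?s L - ?s L * (d + (3/2 - n) * L * c) * 0)\<^sup>2) at_top at_top"
        by (simp add: power_mult_distrib power_divide mult_ac)
      show "a = 0 \<and> b = 0" if "AE k in lborel. complex_of_real a * momentum_limit n f k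
          + complex_of_real b * field_limit n f k = 0" for a b
        by (rule momentum_field_limits_independent[OF n t(3) nz(2) that])
    qed
  qed
qed

lemma dominated_amplitude_sum:
  assumes "test_function (fst \<gamma>)" "test_function (snd \<gamma>)" "L \<ge> 1"
  shows "dominated (amplitude_sum n \<gamma> L)"
proof -
  have "amplitude_sum n \<gamma> L = (\<lambda>k. complex_of_real (L powr (n - 1/2) * L) * normalized_amplitude \<gamma> L k
      + complex_of_real 0 * normalized_amplitude \<gamma> L k)"
    by (intro ext) (simp add: amplitude_sum_normalized[OF assms(3)])
  then show ?thesis
    using dominated_lincomb converges_dominated[OF converges_normalized_amplitude[OF assms(1,2)] assms(3)]
    by metis
qed

text \<open>A linear relation between the G profiles yields a combination of the observables that
  involves only the field. Completing it to a change of determinant 1 preserves the Gram determinant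
  and reduces to the pure field case.\<close>

lemma gram_at_top:
  assumes t: "test_function (fst \<gamma>)" "test_function (snd \<gamma>)" "test_function (fst \<gamma>')" "test_function (snd \<gamma>')"
    and nz: "fst \<gamma> x0 * snd \<gamma>' x0 - snd \<gamma> x0 * fst \<gamma>' x0 \<noteq> 0"
  shows "filterlim (\<lambda>L. gram (amplitude_sum n \<gamma> L) (amplitude_sum n \<gamma>' L)) at_top at_top"
proof (cases "\<forall>a b. (\<forall>x. a * fst \<gamma> x + b * fst \<gamma>' x = 0) \<longrightarrow> a = 0 \<and> b = 0")
  case True
  then show ?thesis by (intro gram_at_top_independent t) blast
next
  case False
  then obtain p q where pq: "\<And>x. p * fst \<gamma> x + q * fst \<gamma>' x = 0" "p \<noteq> 0 \<or> q \<noteq> 0" by blast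
  \<comment> \<open>Dividing (q, -p) by p^2 + q^2 gives the first row whose determinant with the
    second row (p, q) is 1.\<close>
  define r where "r = q / (p\<^sup>2 + q\<^sup>2)"
  define s where "s = - p / (p\<^sup>2 + q\<^sup>2)"
  have "p\<^sup>2 + q\<^sup>2 \<noteq> 0" using pq(2) by (simp add: sum_power2_eq_zero_iff)
  then have det: "r * q - s * p = 1"
    by (simp add: r_def s_def add_divide_distrib[symmetric] power2_eq_square add.commute)
  define \<delta> where "\<delta> = ((\<lambda>x. r * fst \<gamma> x + s * fst \<gamma>' x), (\<lambda>x. r * snd \<gamma> x + s * snd \<gamma>' x))"
  define f where "f = (\<lambda>x. p * snd \<gamma> x + q * snd \<gamma>' x)"
  have f': "((\<lambda>x. 0), f) = ((\<lambda>x. p * fst \<gamma> x + q * fst \<gamma>' x), (\<lambda>x. p * snd \<gamma> x + q * snd \<gamma>' x))"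
    using pq(1) by (simp add: f_def)
  \<comment> \<open>The symplectic density at x0 is invariant under the change; the second summand
    vanishes by the relation, so both factors on the left are nonzero.\<close>
  have "fst \<delta> x0 * f x0 = (r * q - s * p) * (fst \<gamma> x0 * snd \<gamma>' x0 - snd \<gamma> x0 * fst \<gamma>' x0)
      + (r * snd \<gamma> x0 + s * snd \<gamma>' x0) * (p * fst \<gamma> x0 + q * fst \<gamma>' x0)"
    by (simp add: \<delta>_def f_def algebra_simps)
  then have "fst \<delta> x0 * f x0 \<noteq> 0" using nz pq(1) det by simp
  then have nz': "fst \<delta> x0 \<noteq> 0" "f x0 \<noteq> 0" by auto
  have t': "test_function (fst \<delta>)" "test_function (snd \<delta>)" "test_function f"
    unfolding \<delta>_def f_def by (simp_all add: test_function_lincomb t)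
  have "\<forall>\<^sub>F L in at_top. gram (amplitude_sum n \<delta> L) (amplitude_sum n ((\<lambda>x. 0), f) L)
      = gram (amplitude_sum n \<gamma> L) (amplitude_sum n \<gamma>' L)"
    using eventually_ge_at_top[of 1]
  proof eventually_elim
    case (elim L)
    have "amplitude_sum n \<delta> L = (\<lambda>k. complex_of_real r * amplitude_sum n \<gamma> L k + complex_of_real s * amplitude_sum n \<gamma>' L k)"
      unfolding \<delta>_def by (intro ext amplitude_sum_lincomb t)
    moreover have "amplitude_sum n ((\<lambda>x. 0), f) L = (\<lambda>k. complex_of_real p * amplitude_sum n \<gamma> L k + complex_of_real q * amplitude_sum n \<gamma>' L k)"
      unfolding f' by (intro ext amplitude_sum_lincomb t)
    ultimately show ?case
      using gram_lincomb[OF dominated_amplitude_sum[OF t(1,2) elim] dominated_amplitude_sum[OF t(3,4) elim], of r s p q] det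
      by simp
  qed
  then show ?thesis
    using gram_at_top_pure_field[OF t' nz'] filterlim_cong[OF refl refl] by fastforce
qed

lemma filterlim_symplectic_eigenvalue:
  assumes "single_mode \<Gamma>" "\<rho> > 0" "n = sqrt (9/4 - \<rho>\<^sup>2)"
  shows "filterlim (\<lambda>L. symplectic_eigenvalue (bunch_davies (\<rho> * L) L) \<Gamma>) at_top at_top"
proof -
  have t: "test_function (fst (\<Gamma> i))" "test_function (snd (\<Gamma> i))" for i
    using assms(1) by (auto simp: single_mode_def)
  \<comment> \<open>The commutator is the integral of this density; since it equals 1, the density
    is nonzero at some point.\<close>
  obtain x0 where x0: "fst (\<Gamma> 1) x0 * snd (\<Gamma> 2) x0 - snd (\<Gamma> 1) x0 * fst (\<Gamma> 2) x0 \<noteq> 0"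
  proof (rule ccontr)
    assume "\<not> thesis"
    then have "\<And>x. fst (\<Gamma> 1) x * snd (\<Gamma> 2) x - snd (\<Gamma> 1) x * fst (\<Gamma> 2) x = 0" using that by blast
    then have "symplectic (\<Gamma> 1) (\<Gamma> 2) = 0" unfolding symplectic_def by simp
    then show False using assms(1) by (simp add: single_mode_def)
  qed
  \<comment> \<open>The factor 2 of the anticommutator over the (2 pi)^3 of the momentum
    measure.\<close>
  define \<kappa> where "\<kappa> = 2 / (2 * pi) ^ 3"
  have k: "\<kappa> > 0" by (simp add: \<kappa>_def)
  let ?A = "\<lambda>i L. amplitude_sum n (\<Gamma> i) L"
  have "filterlim (\<lambda>L. \<kappa>\<^sup>2 * gram (?A 1 L) (?A 2 L)) at_top at_top"
    using k by (intro filterlim_tendsto_pos_mult_at_top[OF tendsto_const] gram_at_top[OF t t x0]) auto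
  then have "filterlim (\<lambda>L. sqrt (\<kappa>\<^sup>2 * gram (?A 1 L) (?A 2 L))) at_top at_top"
    by (rule filterlim_compose[OF sqrt_at_top])
  moreover have "\<forall>\<^sub>F L in at_top. sqrt (\<kappa>\<^sup>2 * gram (?A 1 L) (?A 2 L))
      = symplectic_eigenvalue (bunch_davies (\<rho> * L) L) \<Gamma>"
    using eventually_ge_at_top[of 1]
  proof eventually_elim
    case (elim L)
    have "mode_amplitude (bunch_davies (\<rho> * L) L) (\<Gamma> i) = ?A i L" for i
      by (intro ext mode_amplitude_bunch_davies[OF assms(2) _ assms(3)]) (use elim in simp)
    then have "covariance (bunch_davies (\<rho> * L) L) \<Gamma> $ i $ j = \<kappa> * ip (?A i L) (?A j L)" for i j
      unfolding covariance_def anticommutator_vev_def ip_def \<kappa>_def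
      by (simp only: vec_lambda_beta integral_divide_zero Re_divide_of_real) simp
    moreover have "ip (?A 2 L) (?A 1 L) = ip (?A 1 L) (?A 2 L)"
      by (intro ip_commute dominated_amplitude_sum t elim)
    ultimately have "det (covariance (bunch_davies (\<rho> * L) L) \<Gamma>) = \<kappa>\<^sup>2 * gram (?A 1 L) (?A 2 L)"
      by (simp add: det_2 gram_def power2_eq_square algebra_simps)
    then show ?case by (simp add: symplectic_eigenvalue_def)
  qed
  ultimately show ?thesis using filterlim_cong[OF refl refl] by fastforce
qed

end

text \<open>The threshold \<Lambda> can be fixed before m and H: after rescaling, only \<rho> and
  the product R H remain.\<close>

theorem proposition1:
  shows "\<exists>\<epsilon>>0. \<forall>\<rho>::real. 0 < \<rho> \<and> \<rho> < \<epsilon> \<longrightarrow>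
    (\<forall>\<Gamma> :: 2 \<Rightarrow> smearing. single_mode \<Gamma> \<longrightarrow>
      (\<exists>\<Lambda>>0. \<forall>m>0. \<forall>H>0. m / H = \<rho> \<longrightarrow>
        (\<forall>R>0. R * H \<ge> \<Lambda> \<longrightarrow>
          mode_entropy (bunch_davies m H) (scale_mode R \<Gamma>)
            \<ge> mode_entropy minkowski (scale_mode R \<Gamma>))))"
proof (rule exI[of _ 1], intro conjI allI impI)
  fix \<rho> :: real and \<Gamma> :: "2 \<Rightarrow> smearing"
  assume "0 < \<rho> \<and> \<rho> < 1" and \<Gamma>: "single_mode \<Gamma>"
  then have \<rho>: "0 < \<rho>" "\<rho> < 1" by auto
  define n where "n = sqrt (9/4 - \<rho>\<^sup>2)"
  have r2: "0 < \<rho>\<^sup>2" "\<rho>\<^sup>2 < 1" using \<rho> power_strict_mono[of \<rho> 1 2] by simp_all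
  \<comment> \<open>The choice \<epsilon> = 1 gives n^2 > 5/4, and \<rho> > 0 gives n^2 <
    9/4.\<close>
  have n: "1 < n" "n < 3/2"
  proof -
    show "1 < n" unfolding n_def using r2 by (simp add: real_less_rsqrt)
    have "n < sqrt ((3/2)\<^sup>2)" unfolding n_def using r2 by (intro real_sqrt_less_mono) (simp add: power2_eq_square)
    then show "n < 3/2" by simp
  qed
  interpret squeezing n by unfold_locales (rule n)+
  have "filterlim (\<lambda>L. mode_entropy (bunch_davies (\<rho> * L) L) \<Gamma>) at_top at_top"
    unfolding mode_entropy_def
    by (rule filterlim_compose[OF filterlim_entropy_fn filterlim_symplectic_eigenvalue[OF \<Gamma> \<rho>(1) n_def]])
  then have "\<forall>\<^sub>F L in at_top. mode_entropy (bunch_davies (\<rho> * L) L) \<Gamma> \<ge> mode_entropy minkowski \<Gamma>"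
    by (simp add: filterlim_at_top)
  then obtain \<Lambda> where \<Lambda>: "\<And>L. L \<ge> \<Lambda> \<Longrightarrow> mode_entropy (bunch_davies (\<rho> * L) L) \<Gamma> \<ge> mode_entropy minkowski \<Gamma>"
    by (auto simp: eventually_at_top_linorder)
  show "\<exists>\<Lambda>>0. \<forall>m>0. \<forall>H>0. m / H = \<rho> \<longrightarrow> (\<forall>R>0. R * H \<ge> \<Lambda> \<longrightarrow>
      mode_entropy (bunch_davies m H) (scale_mode R \<Gamma>) \<ge> mode_entropy minkowski (scale_mode R \<Gamma>))"
  \<comment> \<open>The limit returns a threshold of unknown sign; the maximum makes it
    positive.\<close>
  proof (rule exI[of _ "max 1 \<Lambda>"], intro conjI allI impI)
    fix m H R :: real
    assume h: "0 < m" "0 < H" "m / H = \<rho>" "0 < R" "max 1 \<Lambda> \<le> R * H"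
    have m: "m = \<rho> * H" using h by (simp add: field_simps)
    have "m\<^sup>2 / H\<^sup>2 = \<rho>\<^sup>2" using h(3) by (metis power_divide)
    then have bd: "bd_order m H = n" by (simp add: bd_order_def mu_sq_def n_def)
    have "mode_entropy (bunch_davies m H) (scale_mode R \<Gamma>)
        = mode_entropy (bunch_davies (\<rho> * (H * R)) (H * R)) \<Gamma>"
      unfolding mode_entropy_scale[OF measurable_modes_bunch_davies[OF n[folded bd]] \<Gamma> h(4)]
        scale_modes_bunch_davies[OF h(4,2)] by (simp only: m mult.assoc)
    also have "\<dots> \<ge> mode_entropy minkowski \<Gamma>"
      by (rule \<Lambda>) (use h(5) in \<open>simp add: mult.commute\<close>)
    also have "mode_entropy minkowski \<Gamma> = mode_entropy minkowski (scale_mode R \<Gamma>)"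
      by (simp only: mode_entropy_scale[OF measurable_modes_minkowski \<Gamma> h(4)] scale_modes_minkowski[OF h(4)])
    finally show "mode_entropy minkowski (scale_mode R \<Gamma>) \<le> mode_entropy (bunch_davies m H) (scale_mode R \<Gamma>)" .
  qed simp
qed simp

end
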